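(* Suppose that the coefficients $a_n$ are real. Then there exists $T_0>0$ such that for all integers $N\ge2$ and all $U>0$, if $T\ge T_0$, then $$N_{0,0}(T,U)\ \ge\ \frac{A}{\pi}\bigl((T+U)\log(T+U)-T\log T\bigr)+O(U\log N),$$ where the implied constant does not depend on $N,T,U$.
   Context: Write $s=\sigma+it$ with $\sigma,t\in\mathbb{R}$. Let $F(s)=\sum_{n=1}^\infty a_n\lambda_n^{-s}$ be a general Dirichlet series, absolutely convergent in some half-plane, with $a_n\in\mathbb{C}$, $\lambda_n$ real and strictly increasing, $\lambda_1=1$ (so $\lambda_n\ge1$), $a_2\neq0$, $a_3\ne0$ (possibly $a_1=0$), and $|a_n|$, $\lambda_n$ growing at most polynomially in $n$. Assume $F$ satisfies the functional equation $$\Omega(s)F(s)=\lambda^{2s-\delta}\Omega(\delta-s)F(\delta-s),\qquad \Omega(s)=\prod_{i=1}^k\Gamma(\alpha_is+\beta_i),$$ with $\lambda>0$, $\delta\in\mathbb{R}$, $\alpha_i>0$, $\beta_i\in\mathbb{R}$. Put $$F_N(s)=\sum_{n=1}^N\frac{a_n}{\lambda_n^s},\qquad G(s)=\lambda^{2s-\delta}\frac{\Omega(\delta-s)}{\Omega(s)},\qquad \zeta_N(s)=F_N(s)+G(s)F_N(\delta-s),\qquad A=\sum_{i=1}^k\alpha_i.$$ The critical line is $\sigma=\delta/2$. $N_{0,0}(T,U)$ is the number of zeros of $\zeta_N(s)$, counted with multiplicity, on the critical line $\sigma=\delta/2$ with $T<t<T+U$. It is always assumed that $T,U$ are such that the endpoints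 $\delta/2+iT$ and $\delta/2+i(T+U)$ are not zeros.
   Formalization: The error term O(U log N) is replaced by O(max(1,U) log N): as stated for all U>0 the claim fails for very short intervals containing no zeros when T is large; for U≥1 the two error terms coincide. *)

theory Defs
  imports "HOL-Complex_Analysis.Complex_Analysis"
begin

text \<open>
  The coefficients and frequencies \<open>a, l :: nat \<Rightarrow> _\<close> are indexed from 1, as are the parameters
  \<open>\<alpha>, \<beta> :: nat \<Rightarrow> real\<close> of the Gamma factors; values at index 0 are irrelevant.  The frequencies
  are \<open>l n\<close>; \<open>lam\<close> is the base of the exponential factor in the functional equation.
\<close>

definition dirichlet_term :: "(nat \<Rightarrow> complex) \<Rightarrow> (nat \<Rightarrow> real) \<Rightarrow> complex \<Rightarrow> nat \<Rightarrow> complex" where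
  "dirichlet_term a l s n = a n / of_real (l n) powr s"

definition Omega :: "nat \<Rightarrow> (nat \<Rightarrow> real) \<Rightarrow> (nat \<Rightarrow> real) \<Rightarrow> complex \<Rightarrow> complex" where
  "Omega k \<alpha> \<beta> s = (\<Prod>i=1..k. Gamma (of_real (\<alpha> i) * s + of_real (\<beta> i)))"

text \<open>
  \<open>F\<close> is the meromorphic continuation to the whole plane of the general Dirichlet series, which
  converges absolutely for \<open>Re s > \<sigma>\<^sub>0\<close>.
\<close>

definition continues_dirichlet_series ::
    "(complex \<Rightarrow> complex) \<Rightarrow> (nat \<Rightarrow> complex) \<Rightarrow> (nat \<Rightarrow> real) \<Rightarrow> real \<Rightarrow> bool" where
  "continues_dirichlet_series F a l \<sigma>\<^sub>0 \<longleftrightarrow>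
     F meromorphic_on UNIV \<and>
     (\<forall>s. Re s > \<sigma>\<^sub>0 \<longrightarrow>
        summable (\<lambda>n. norm (dirichlet_term a l s (Suc n))) \<and>
        F s = (\<Sum>n. dirichlet_term a l s (Suc n)))"

text \<open>
  The functional equation is an identity of meromorphic functions, so it is required off a set
  without limit points: at poles, the values of \<open>F\<close> and of \<open>Gamma\<close> (which is 0 there
  by convention) carry no meaning.
\<close>

definition functional_equation ::
    "(complex \<Rightarrow> complex) \<Rightarrow> nat \<Rightarrow> (nat \<Rightarrow> real) \<Rightarrow> (nat \<Rightarrow> real) \<Rightarrow> real \<Rightarrow> real \<Rightarrow> bool" where
  "functional_equation F k \<alpha> \<beta> lam \<delta> \<longleftrightarrow>
     (\<forall>\<^sub>\<approx>s. Omega k \<alpha> \<beta> s * F s =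
        of_real lam powr (2 * s - of_real \<delta>) * Omega k \<alpha> \<beta> (of_real \<delta> - s) * F (of_real \<delta> - s))"

definition F_part :: "(nat \<Rightarrow> complex) \<Rightarrow> (nat \<Rightarrow> real) \<Rightarrow> nat \<Rightarrow> complex \<Rightarrow> complex" where
  "F_part a l N s = (\<Sum>n=1..N. dirichlet_term a l s n)"

text \<open>
  The poles of the Gamma factors of \<open>Omega k \<alpha> \<beta> s\<close> and \<open>Omega k \<alpha> \<beta> (\<delta> - s)\<close> are real, so for
  \<open>Im s \<noteq> 0\<close> the pointwise definition below has the intended (analytic) values.
\<close>

definition G_factor ::
    "nat \<Rightarrow> (nat \<Rightarrow> real) \<Rightarrow> (nat \<Rightarrow> real) \<Rightarrow> real \<Rightarrow> real \<Rightarrow> complex \<Rightarrow> complex" where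
  "G_factor k \<alpha> \<beta> lam \<delta> s =
     of_real lam powr (2 * s - of_real \<delta>) * (Omega k \<alpha> \<beta> (of_real \<delta> - s) / Omega k \<alpha> \<beta> s)"

definition zeta_part ::
    "(nat \<Rightarrow> complex) \<Rightarrow> (nat \<Rightarrow> real) \<Rightarrow> nat \<Rightarrow> (nat \<Rightarrow> real) \<Rightarrow> (nat \<Rightarrow> real) \<Rightarrow> real \<Rightarrow> real \<Rightarrow>
     nat \<Rightarrow> complex \<Rightarrow> complex" where
  "zeta_part a l k \<alpha> \<beta> lam \<delta> N s =
     F_part a l N s + G_factor k \<alpha> \<beta> lam \<delta> s * F_part a l N (of_real \<delta> - s)"

text \<open>
  Zeros of \<open>f\<close> on the line \<open>Re s = c\<close> with \<open>T < Im s < T + U\<close>, counted with multiplicity.  When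
  \<open>f\<close> is analytic near the closed segment and nonzero at one of its endpoints (the only situation
  considered), the index set is finite and \<open>zorder f z\<close> is the multiplicity of the zero \<open>z\<close>.
\<close>

definition zeros_on_line :: "(complex \<Rightarrow> complex) \<Rightarrow> real \<Rightarrow> real \<Rightarrow> real \<Rightarrow> int" where
  "zeros_on_line f c T U =
     (\<Sum>z\<in>{z. Re z = c \<and> T < Im z \<and> Im z < T + U \<and> f z = 0}. zorder f z)"

end

(*
  Put s = \<delta>/2 + it and let \<theta>(t) be the continuous argument of lam^(-it) \<Omega>(s).  On the critical
  line G(s) = e^(-2 i \<theta>(t)) and F_N(\<delta> - s) is the conjugate of F_N(s), so
  zeta_N(s) = 2 e^(-i \<theta>) Re (e^(i \<theta>) F_N(s)) vanishes whenever the phase \<theta> + \<phi> is an odd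
  multiple of \<pi>/2, where F_N(s) = q(t) e^(i \<phi>(t)) with q real and \<phi> continuous.  Between two
  heights the number of such points is at least the increment of \<theta> + \<phi> over \<pi>, minus one.

  The increment of \<theta> is at least A times that of t log t up to O(U), since its derivative is
  controlled from below by Re (Digamma z) \<ge> log (Im z) - O(1).  On a unit interval \<phi> oscillates by
  O(log N): F_N is bounded below far to the right (by its leading term) and above by a power of N on
  a disc around such a point that contains the interval.  Hence it has O(log N) zeros in a smaller
  disc, each contributing at most 2 \<pi> to \<phi> (real zeros go into q), and the logarithm of the
  zero-free cofactor is O(log N) by the Borel-Caratheodory inequality.
*)

theory Submission
  imports Defs
begin

subsection \<open>Zeros and zero-free factors of holomorphic functions on discs\<close>

text \<open>The Moebius map w -> w / (2A - w) fixes 0 and sends the half-plane Re w < A into the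
  unit disc. Schwarz's lemma bounds the composite by 1/2 on the half-radius disc, and solving back
  for \<open>g\<close> gives \<open>2 * A\<close>.\<close>

lemma Borel_Caratheodory_half:
  fixes g :: "complex \<Rightarrow> complex"
  assumes r: "r > 0" and holg: "g holomorphic_on ball c r" and g0: "g c = 0"
    and Re_less: "\<And>z. z \<in> ball c r \<Longrightarrow> Re (g z) < A"
    and z: "z \<in> cball c (r / 2)"
  shows "norm (g z) \<le> 2 * A"
proof -
  have A: "A > 0"
    using Re_less[of c] g0 r by simp
  define h where "h = (\<lambda>w. g (c + of_real r * w))"
  define f where "f = (\<lambda>w. h w / (2 * of_real A - h w))"
  have in_ball: "c + of_real r * w \<in> ball c r" if "norm w < 1" for w
    using that r by (simp add: dist_norm norm_mult)
  have Re_h: "Re (h w) < A" if "norm w < 1" for w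
    unfolding h_def using Re_less[OF in_ball[OF that]] .
  have nz: "2 * of_real A - h w \<noteq> 0" if "norm w < 1" for w
    using Re_h[OF that] A by (auto simp: complex_eq_iff)
  have holh: "h holomorphic_on ball 0 1"
    unfolding h_def
    by (rule holomorphic_on_compose_gen[OF _ holg, unfolded o_def])
       (use in_ball in \<open>auto intro!: holomorphic_intros\<close>)
  have holf: "f holomorphic_on ball 0 1"
    unfolding f_def by (intro holomorphic_intros holh) (use nz in auto)
  have f0: "f 0 = 0"
    by (simp add: f_def h_def g0)
  have norm_f: "norm (f w) < 1" if "norm w < 1" for w
  proof -
    \<comment> \<open>The two squares differ by 4A (A - Re h), which is positive.\<close>
    have "(norm (h w))\<^sup>2 < (norm (2 * of_real A - h w))\<^sup>2"
      using mult_strict_left_mono[OF Re_h[OF that] A]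
      unfolding cmod_power2 by (simp add: power2_eq_square algebra_simps)
    then have "norm (h w) < norm (2 * of_real A - h w)"
      by (rule power2_less_imp_less) simp
    then show ?thesis
      unfolding f_def norm_divide using nz[OF that] by (simp add: divide_less_eq)
  qed
  define w where "w = (z - c) / of_real r"
  have w: "norm w \<le> 1 / 2"
    using z r by (simp add: w_def norm_divide dist_norm norm_minus_commute field_simps)
  have "norm (f w) \<le> norm w"
    by (rule Schwarz_Lemma(1)[OF holf f0 norm_f]) (use w in auto)
  then have "norm (f w) \<le> 1 / 2"
    using w by simp
  then have "norm (h w) \<le> norm (2 * of_real A - h w) / 2"
    using nz[of w] w by (simp add: f_def norm_divide field_simps)
  also have "\<dots> \<le> (2 * A + norm (h w)) / 2"
    using norm_triangle_ineq4[of "2 * of_real A" "h w"] A by (simp add: norm_mult)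
  finally have "norm (h w) \<le> 2 * A"
    by simp
  moreover have "h w = g z"
    using r by (simp add: h_def w_def)
  ultimately show ?thesis
    by simp
qed

section \<open>Splitting off the zeros in a disc\<close>

lemma norm_prod_list: "norm (prod_list xs :: 'a :: real_normed_field) = (\<Prod>x\<leftarrow>xs. norm x)"
  by (induction xs) (auto simp: norm_mult)

lemma prod_list_le_power:
  fixes f :: "'a \<Rightarrow> real"
  assumes "\<And>x. x \<in> set xs \<Longrightarrow> 0 \<le> f x" "\<And>x. x \<in> set xs \<Longrightarrow> f x \<le> b"
  shows "(\<Prod>x\<leftarrow>xs. f x) \<le> b ^ length xs"
  using assms
proof (induction xs)
  case (Cons x xs)
  have "0 \<le> (\<Prod>x\<leftarrow>xs. f x)"
    using Cons.prems(1) by (intro prod_list_nonneg) auto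
  moreover have "0 \<le> f x" "f x \<le> b"
    using Cons.prems by simp_all
  moreover from this have "0 \<le> b"
    by linarith
  ultimately show ?case
    using Cons by (auto intro!: mult_mono)
qed simp

lemma power_le_prod_list:
  fixes f :: "'a \<Rightarrow> real"
  assumes "0 \<le> b" "\<And>x. x \<in> set xs \<Longrightarrow> b \<le> f x"
  shows "b ^ length xs \<le> (\<Prod>x\<leftarrow>xs. f x)"
  using assms
proof (induction xs)
  case (Cons x xs)
  have "b \<le> f x"
    using Cons.prems by simp
  moreover from this have "0 \<le> f x"
    using Cons.prems by linarith
  ultimately show ?case
    using Cons by (auto intro!: mult_mono)
qed simp

text \<open>A Jensen-type count: on the circle of radius 3r each factor z - \<rho> has modulus at
  least 2r, at the centre at most r, so each listed zero costs a factor 2 between the boundary bound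
  and the value at \<open>c\<close>. \<open>R\<close> may still vanish, so the estimate covers
  incomplete factorizations as well; \<open>zero_factorization\<close> relies on this.\<close>

lemma zero_factor_bounds:
  fixes P R :: "complex \<Rightarrow> complex"
  assumes r: "r > 0" and S: "open S" "cball c (3 * r) \<subseteq> S"
    and holR: "R holomorphic_on S"
    and eq: "\<And>z. z \<in> S \<Longrightarrow> P z = (\<Prod>\<rho>\<leftarrow>rs. z - \<rho>) * R z"
    and rs: "set rs \<subseteq> cball c r"
    and M: "\<And>z. z \<in> cball c (3 * r) \<Longrightarrow> norm (P z) \<le> M"
    and Pc: "P c \<noteq> 0"
  shows "2 ^ length rs \<le> M / norm (P c)"
    and "z \<in> cball c (3 * r) \<Longrightarrow> norm (R z) \<le> M / norm (P c) * norm (R c)"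
proof -
  define n where "n = length rs"
  have c: "c \<in> S"
    using S r by force
  \<comment> \<open>The maximum principle carries the bound from the circle, where the linear
    factors are large, to the whole disc.\<close>
  have R_le: "norm (R z) \<le> M / (2 * r) ^ n" if z: "z \<in> cball c (3 * r)" for z
  proof (rule maximum_modulus_frontier[of R "cball c (3 * r)"])
    show "R holomorphic_on interior (cball c (3 * r))"
      using holR by (rule holomorphic_on_subset) (use S interior_subset in blast)
    show "continuous_on (closure (cball c (3 * r))) R"
      using holomorphic_on_imp_continuous_on[OF holR] continuous_on_subset S by auto
    fix w assume "w \<in> frontier (cball c (3 * r))"
    then have w: "dist c w = 3 * r"
      using r by (simp add: frontier_cball)
    have far: "2 * r \<le> norm (w - \<rho>)" if "\<rho> \<in> set rs" for \<rho>
      using dist_triangle[of c w \<rho>] that rs w by (auto simp: dist_norm norm_minus_commute)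
    have "(2 * r) ^ n \<le> norm (\<Prod>\<rho>\<leftarrow>rs. w - \<rho>)"
      unfolding n_def norm_prod_list map_map o_def by (rule power_le_prod_list) (use r far in auto)
    then have "(2 * r) ^ n * norm (R w) \<le> norm (P w)"
      using eq[of w] S w by (subst eq) (auto simp: norm_mult intro!: mult_right_mono)
    also have "\<dots> \<le> M"
      using M[of w] w by simp
    finally show "norm (R w) \<le> M / (2 * r) ^ n"
      using r by (simp add: field_simps)
  qed (use z in auto)
  have "norm (\<Prod>\<rho>\<leftarrow>rs. c - \<rho>) \<le> r ^ n"
    unfolding n_def norm_prod_list map_map o_def by (rule prod_list_le_power) (use rs in \<open>auto simp: dist_norm\<close>)
  then have Pc_le: "norm (P c) \<le> r ^ n * norm (R c)"
    using eq[OF c] by (auto simp: norm_mult intro!: mult_right_mono)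
  have M0: "M \<ge> 0"
    using M[of c] r by (smt (verit) centre_in_cball norm_ge_zero)
  have "norm (P c) \<le> r ^ n * (M / (2 * r) ^ n)"
    using Pc_le R_le[of c] r by (meson centre_in_cball mult_left_mono order_trans zero_le_power less_imp_le mult_nonneg_nonneg zero_le_numeral)
  also have "\<dots> = M / 2 ^ n"
    using r by (simp add: power_mult_distrib)
  finally show "2 ^ length rs \<le> M / norm (P c)"
    using Pc by (simp add: n_def field_simps)
  assume z: "z \<in> cball c (3 * r)"
  have "norm (R z) \<le> M / (2 * r) ^ n"
    by (rule R_le[OF z])
  \<comment> \<open>The gain of 2^n is given up, so that the remaining 1 / r^n can be traded for
    norm (R c) / norm (P c) by \<open>Pc_le\<close>.\<close>
  also have "\<dots> \<le> M / r ^ n"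
    using M0 r by (intro divide_left_mono power_mono mult_pos_pos) auto
  also have "\<dots> \<le> M / norm (P c) * norm (R c)"
    using mult_left_mono[OF Pc_le M0] r Pc by (simp add: field_simps)
  finally show "norm (R z) \<le> M / norm (P c) * norm (R c)" .
qed

text \<open>A list of split-off zeros of maximal length exists because
  \<open>zero_factor_bounds\<close> caps the length of every admissible list; by maximality the
  cofactor has no zero left in \<open>cball c r\<close>. Repeated entries record
  multiplicity.\<close>

lemma zero_factorization:
  fixes P :: "complex \<Rightarrow> complex"
  assumes r: "r > 0" and S: "open S" "cball c (3 * r) \<subseteq> S"
    and holP: "P holomorphic_on S"
    and M: "\<And>z. z \<in> cball c (3 * r) \<Longrightarrow> norm (P z) \<le> M"
    and Pc: "P c \<noteq> 0"
  obtains rs R where "R holomorphic_on S" "\<And>z. z \<in> S \<Longrightarrow> P z = (\<Prod>\<rho>\<leftarrow>rs. z - \<rho>) * R z"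
    "\<And>z. z \<in> cball c r \<Longrightarrow> R z \<noteq> 0"
    "2 ^ length rs \<le> M / norm (P c)"
    "\<And>z. z \<in> cball c (3 * r) \<Longrightarrow> norm (R z) \<le> M / norm (P c) * norm (R c)"
proof -
  define ok where "ok = (\<lambda>rs R. R holomorphic_on S \<and> (\<forall>z\<in>S. P z = (\<Prod>\<rho>\<leftarrow>rs. z - \<rho>) * R z) \<and>
    set rs \<subseteq> cball c r)"
  have ok_bound: "length rs < nat \<lceil>M / norm (P c)\<rceil>" if "ok rs R" for rs R
  proof -
    have "2 ^ length rs \<le> M / norm (P c)"
      by (rule zero_factor_bounds(1)[of r S c R P rs M]) (use that r S M Pc in \<open>auto simp: ok_def\<close>)
    moreover have "real (length rs) < 2 ^ length rs"
      by (rule of_nat_less_two_power)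
    ultimately show ?thesis
      by linarith
  qed
  have ok_Nil: "ok [] P"
    by (simp add: ok_def holP)
  define Q where "Q = (\<lambda>n. \<exists>rs R. ok rs R \<and> length rs = n)"
  have Q_bound: "n \<le> nat \<lceil>M / norm (P c)\<rceil>" if "Q n" for n
    using that ok_bound unfolding Q_def by (auto simp: less_imp_le)
  have "\<exists>n. Q n"
    using ok_Nil unfolding Q_def by blast
  then obtain n where n: "Q n" "\<And>m. Q m \<Longrightarrow> m \<le> n"
    using GreatestI_ex_nat[of Q] Greatest_le_nat[of Q] Q_bound by blast
  then obtain rs R where ok: "ok rs R" and len: "length rs = n"
    unfolding Q_def by blast
  have R_nz: "R \<rho> \<noteq> 0" if \<rho>: "\<rho> \<in> cball c r" for \<rho>
  proof
    assume R0: "R \<rho> = 0"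
    \<comment> \<open>The quotient of \<open>R\<close> by z - \<rho> with its singularity removed;
      the value \<open>deriv R \<rho>\<close> makes it holomorphic at \<rho>.\<close>
    define R' where "R' = (\<lambda>z. if z = \<rho> then deriv R \<rho> else (R z - R \<rho>) / (z - \<rho>))"
    have "R' holomorphic_on S"
      unfolding R'_def using ok S by (intro pole_lemma_open) (auto simp: ok_def)
    moreover have "R z = (z - \<rho>) * R' z" for z
      by (simp add: R'_def R0)
    ultimately have "ok (rs @ [\<rho>]) R'"
      using ok \<rho> unfolding ok_def by (auto simp: mult.assoc)
    then show False
      using n(2)[of "Suc n"] len unfolding Q_def by fastforce
  qed
  have "2 ^ length rs \<le> M / norm (P c)"
    by (rule zero_factor_bounds(1)[of r S c R P rs M]) (use ok r S M Pc in \<open>auto simp: ok_def\<close>)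
  moreover have "norm (R z) \<le> M / norm (P c) * norm (R c)" if "z \<in> cball c (3 * r)" for z
    by (rule zero_factor_bounds(2)[of r S c R P rs M]) (use ok r S M Pc that in \<open>auto simp: ok_def\<close>)
  ultimately show ?thesis
    using that[of R rs] ok R_nz unfolding ok_def by blast
qed

subsection \<open>The phase of a holomorphic function along a real segment\<close>

text \<open>If \<rho> is real, the sign change of t - \<rho> goes into the real factor
  \<open>q\<close> and the phase is constant. Otherwise t - \<rho> keeps a fixed nonzero imaginary
  part, so it never meets the cut of \<open>Arg\<close>, whose range gives the bound.\<close>

lemma linear_factor_phase:
  fixes \<rho> :: complex
  shows "\<exists>q \<phi> :: real \<Rightarrow> real. continuous_on UNIV \<phi> \<and>
    (\<forall>t. of_real t - \<rho> = of_real (q t) * cis (\<phi> t)) \<and> (\<forall>x y. \<bar>\<phi> x - \<phi> y\<bar> \<le> 2 * pi)"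
proof (cases "\<rho> \<in> \<real>")
  case True
  then obtain x where "\<rho> = of_real x"
    by (auto elim: Reals_cases)
  then show ?thesis
    by - (rule exI[of _ "\<lambda>t. t - x"], rule exI[of _ "\<lambda>_. 0"], auto)
next
  case False
  have ne: "of_real t - \<rho> \<notin> \<real>\<^sub>\<le>\<^sub>0" for t
    using False by (auto simp: complex_nonpos_Reals_iff complex_is_Real_iff)
  show ?thesis
  proof (rule exI[of _ "\<lambda>t. norm (of_real t - \<rho>)"], rule exI[of _ "\<lambda>t. Arg (of_real t - \<rho>)"], intro conjI allI)
    show "continuous_on UNIV (\<lambda>t. Arg (of_real t - \<rho>))"
      by (intro continuous_on_Arg' continuous_intros) (use ne in auto)
    show "of_real t - \<rho> = of_real (norm (of_real t - \<rho>)) * cis (Arg (of_real t - \<rho>))" for t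
      by (metis rcis_cmod_Arg rcis_def)
    show "\<bar>Arg (of_real x - \<rho>) - Arg (of_real y - \<rho>)\<bar> \<le> 2 * pi" for x y
      using Arg_bounded[of "of_real x - \<rho>"] Arg_bounded[of "of_real y - \<rho>"] by linarith
  qed
qed

lemma linear_factors_phase:
  fixes rs :: "complex list"
  shows "\<exists>q \<phi> :: real \<Rightarrow> real. continuous_on UNIV \<phi> \<and>
    (\<forall>t. (\<Prod>\<rho>\<leftarrow>rs. of_real t - \<rho>) = of_real (q t) * cis (\<phi> t)) \<and>
    (\<forall>x y. \<bar>\<phi> x - \<phi> y\<bar> \<le> 2 * pi * length rs)"
proof (induction rs)
  case Nil
  show ?case
    by (rule exI[of _ "\<lambda>_. 1"], rule exI[of _ "\<lambda>_. 0"]) auto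
next
  case (Cons \<rho> rs)
  then obtain q \<phi> :: "real \<Rightarrow> real" where 1: "continuous_on UNIV \<phi>"
    "\<And>t. (\<Prod>\<rho>\<leftarrow>rs. of_real t - \<rho>) = of_real (q t) * cis (\<phi> t)"
    "\<And>x y. \<bar>\<phi> x - \<phi> y\<bar> \<le> 2 * pi * length rs"
    by blast
  obtain q' \<phi>' :: "real \<Rightarrow> real" where 2: "continuous_on UNIV \<phi>'"
    "\<And>t. of_real t - \<rho> = of_real (q' t) * cis (\<phi>' t)" "\<And>x y. \<bar>\<phi>' x - \<phi>' y\<bar> \<le> 2 * pi"
    using linear_factor_phase[of \<rho>] by blast
  have "\<bar>(\<phi>' x + \<phi> x) - (\<phi>' y + \<phi> y)\<bar> \<le> 2 * pi * length (\<rho> # rs)" for x y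
    using 1(3)[of x y] 2(3)[of x y] by (simp add: algebra_simps)
  moreover have "(\<Prod>\<rho>\<leftarrow>\<rho> # rs. of_real t - \<rho>) = of_real (q' t * q t) * cis (\<phi>' t + \<phi> t)" for t
    by (simp add: 1(2) 2(2) flip: cis_mult)
  moreover have "continuous_on UNIV (\<lambda>t. \<phi>' t + \<phi> t)"
    by (intro continuous_intros 1 2)
  ultimately show ?case
    by - (rule exI[of _ "\<lambda>t. q' t * q t"], rule exI[of _ "\<lambda>t. \<phi>' t + \<phi> t"], blast)
qed

text \<open>The radii are nested: \<open>M\<close> bounds \<open>P\<close> on radius 3r, the
  cofactor is zero-free on radius r and hence an exponential of some \<open>h\<close>, and
  Borel-Caratheodory controls \<open>h\<close> on radius r/2, where the segment lies. The phase is
  the sum of the phases of the linear factors and Im h. Letting \<open>q\<close> vanish and change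
  sign allows a continuous phase through zeros on the segment.\<close>

lemma phase_on_real_segment:
  fixes P :: "complex \<Rightarrow> complex" and u v :: real
  assumes r: "r > 0" and S: "open S" "cball c (3 * r) \<subseteq> S"
    and holP: "P holomorphic_on S"
    and M: "\<And>z. z \<in> cball c (3 * r) \<Longrightarrow> norm (P z) \<le> M"
    and Pc: "P c \<noteq> 0"
    and seg: "of_real ` {u..v} \<subseteq> cball c (r / 2)"
  shows "\<exists>q \<phi> :: real \<Rightarrow> real. continuous_on {u..v} \<phi> \<and>
    (\<forall>t\<in>{u..v}. P (of_real t) = of_real (q t) * cis (\<phi> t)) \<and>
    (\<forall>x\<in>{u..v}. \<forall>y\<in>{u..v}. \<bar>\<phi> x - \<phi> y\<bar> \<le> 16 * (1 + ln (M / norm (P c))))"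
proof -
  define L where "L = ln (M / norm (P c))"
  obtain rs R where R: "R holomorphic_on S" "\<And>z. z \<in> S \<Longrightarrow> P z = (\<Prod>\<rho>\<leftarrow>rs. z - \<rho>) * R z"
    "\<And>z. z \<in> cball c r \<Longrightarrow> R z \<noteq> 0"
    "2 ^ length rs \<le> M / norm (P c)"
    "\<And>z. z \<in> cball c (3 * r) \<Longrightarrow> norm (R z) \<le> M / norm (P c) * norm (R c)"
    using zero_factorization[OF r S holP M Pc] by metis
  have sub: "ball c r \<subseteq> S" "cball c (r / 2) \<subseteq> S" "cball c (r / 2) \<subseteq> ball c r"
    using S r by auto
  obtain h where h: "h holomorphic_on ball c r" "\<And>z. z \<in> ball c r \<Longrightarrow> R z = exp (h z)"
    using simply_connected_eq_holomorphic_log[of "ball c r"] convex_imp_simply_connected[of "ball c r"]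
      R(3) holomorphic_on_subset[OF R(1) sub(1)] by auto
  have ratio_pos: "M / norm (P c) > 0"
    using R(4) by (smt (verit) zero_less_power)
  have "ln (2 ^ length rs) \<le> L"
    unfolding L_def using R(4) ratio_pos by simp
  then have len: "length rs * ln 2 \<le> L"
    by (simp add: ln_realpow)
  have "2 / 3 * length rs \<le> ln 2 * length rs"
    by (intro mult_right_mono ln2_ge_two_thirds) auto
  then have len': "length rs \<le> 3 / 2 * L"
    using len by (simp add: algebra_simps)
  \<comment> \<open>The real part is only known to be at most \<open>L\<close>; the extra 1 supplies
    the strict inequality that \<open>Borel_Caratheodory_half\<close> asks for.\<close>
  have g_less: "Re (h z - h c) < L + 1" if "z \<in> ball c r" for z
  proof -
    have "norm (R z) \<le> M / norm (P c) * norm (R c)"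
      using that r by (intro R(5)) simp
    then have "exp (Re (h z)) \<le> M / norm (P c) * exp (Re (h c))"
      using h(2)[of z] h(2)[of c] that r by simp
    then have "exp (Re (h z - h c)) \<le> M / norm (P c)"
      by (simp add: exp_diff divide_le_eq)
    then have "Re (h z - h c) \<le> L"
      unfolding L_def using ratio_pos by (simp add: ln_ge_iff)
    then show ?thesis
      by simp
  qed
  have g_bound: "norm (h z - h c) \<le> 2 * (L + 1)" if "z \<in> cball c (r / 2)" for z
    by (rule Borel_Caratheodory_half[where g = "\<lambda>z. h z - h c", OF r _ _ g_less that])
       (auto intro!: holomorphic_intros h)
  obtain q \<phi> :: "real \<Rightarrow> real" where q: "continuous_on UNIV \<phi>"
    "\<And>t. (\<Prod>\<rho>\<leftarrow>rs. of_real t - \<rho>) = of_real (q t) * cis (\<phi> t)"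
    "\<And>x y. \<bar>\<phi> x - \<phi> y\<bar> \<le> 2 * pi * length rs"
    using linear_factors_phase[of rs] by blast
  show ?thesis
  proof (rule exI[of _ "\<lambda>t. q t * exp (Re (h (of_real t)))"],
      rule exI[of _ "\<lambda>t. \<phi> t + Im (h (of_real t))"], intro conjI ballI)
    have "continuous_on {u..v} (\<lambda>t. h (of_real t))"
      by (rule continuous_on_compose2[OF holomorphic_on_imp_continuous_on[OF h(1)]])
         (use seg sub in \<open>auto intro!: continuous_intros\<close>)
    then show "continuous_on {u..v} (\<lambda>t. \<phi> t + Im (h (of_real t)))"
      by (intro continuous_intros continuous_on_subset[OF q(1)]) auto
  next
    fix t assume t: "t \<in> {u..v}"
    have "of_real t \<in> ball c r"
      using t seg sub by blast
    then have "P (of_real t) = of_real (q t) * cis (\<phi> t) * exp (h (of_real t))"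
      using R(2) h(2) q(2) sub by (metis subsetD)
    then show "P (of_real t) =
        of_real (q t * exp (Re (h (of_real t)))) * cis (\<phi> t + Im (h (of_real t)))"
      by (simp add: exp_eq_polar[of "h (of_real t)"] cis_mult [symmetric] exp_of_real mult_ac)
  next
    fix x y assume x: "x \<in> {u..v}" and y: "y \<in> {u..v}"
    have "norm (h (of_real x) - h c) \<le> 2 * (L + 1)" "norm (h (of_real y) - h c) \<le> 2 * (L + 1)"
      using x y seg by (blast intro: g_bound)+
    then have "\<bar>Im (h (of_real x) - h c)\<bar> \<le> 2 * (L + 1)" "\<bar>Im (h (of_real y) - h c)\<bar> \<le> 2 * (L + 1)"
      using abs_Im_le_cmod order_trans by blast+
    then have "\<bar>Im (h (of_real x)) - Im (h (of_real y))\<bar> \<le> 4 * (L + 1)"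
      by simp
    moreover have "2 * pi * real (length rs) \<le> 8 * real (length rs)"
      using pi_less_4 by (intro mult_right_mono) auto
    ultimately have "\<bar>(\<phi> x + Im (h (of_real x))) - (\<phi> y + Im (h (of_real y)))\<bar> \<le>
        8 * real (length rs) + 4 * (L + 1)"
      using q(3)[of x y] by linarith
    \<comment> \<open>By ln 2 >= 2/3 the zeros contribute at most 12 L, and the logarithm of the
      cofactor contributes 4 L + 4.\<close>
    also have "\<dots> \<le> 16 * (1 + L)"
    proof -
      have "8 * real (length rs) \<le> 12 * L"
        using len' by simp
      then show ?thesis
        by simp
    qed
    finally show "\<bar>(\<phi> x + Im (h (of_real x))) - (\<phi> y + Im (h (of_real y)))\<bar>
        \<le> 16 * (1 + ln (M / norm (P c)))"
      unfolding L_def .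
  qed
qed

text \<open>The intermediate value theorem gives a point for each odd multiple of pi/2 strictly
  between the end values, and distinct multiples give distinct points, whether or not \<psi> is
  monotone. An open interval of length d contains at least d - 1 integers, hence the loss of
  1.\<close>

lemma card_cos_zeros_ge:
  fixes \<psi> :: "real \<Rightarrow> real"
  assumes uv: "u \<le> v" and cont: "continuous_on {u..v} \<psi>" and fin: "finite Z"
    and Z: "\<And>t. u < t \<Longrightarrow> t < v \<Longrightarrow> cos (\<psi> t) = 0 \<Longrightarrow> t \<in> Z"
  shows "(\<psi> v - \<psi> u) / pi - 1 \<le> card Z"
proof -
  define a b where "a = \<psi> u / pi - 1 / 2" and "b = \<psi> v / pi - 1 / 2"
  \<comment> \<open>The integers strictly between \<open>a\<close> and \<open>b\<close>; strictness
    keeps the points found away from \<open>u\<close> and \<open>v\<close>, which \<open>Z\<close>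
    need not contain.\<close>
  define K where "K = {\<lfloor>a\<rfloor> + 1..\<lceil>b\<rceil> - 1}"
  have "\<exists>t. t \<in> Z \<and> \<psi> t = (of_int k + 1 / 2) * pi" if "k \<in> K" for k
  proof -
    have "a < of_int k" "of_int k < b"
      using that unfolding K_def by (auto simp: floor_less_iff less_ceiling_iff) linarith+
    then have k: "\<psi> u < (of_int k + 1 / 2) * pi" "(of_int k + 1 / 2) * pi < \<psi> v"
      by (simp_all add: a_def b_def field_simps)
    then obtain t where t: "u \<le> t" "t \<le> v" "\<psi> t = (of_int k + 1 / 2) * pi"
      using IVT'[of \<psi> u "(of_int k + 1 / 2) * pi" v] uv cont by auto
    have "cos (\<psi> t) = 0"
      unfolding t(3) by (simp add: algebra_simps cos_add sin_zero_iff_int2)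
    moreover have "u \<noteq> t" "t \<noteq> v"
      using t k by auto
    ultimately show ?thesis
      using t Z[of t] by auto
  qed
  then obtain f where f: "\<And>k. k \<in> K \<Longrightarrow> f k \<in> Z" "\<And>k. k \<in> K \<Longrightarrow> \<psi> (f k) = (of_int k + 1 / 2) * pi"
    by metis
  have "inj_on f K"
  proof (rule inj_onI)
    fix j k assume "j \<in> K" "k \<in> K" "f j = f k"
    then have "(of_int j + 1 / 2) * pi = (of_int k + 1 / 2) * pi"
      using f(2) by metis
    then show "j = k"
      by simp
  qed
  then have "card K \<le> card Z"
    using f(1) fin by (intro card_inj_on_le) auto
  moreover have "b - a - 1 \<le> card K"
    unfolding K_def by simp linarith
  ultimately show ?thesis
    by (simp add: a_def b_def diff_divide_distrib)
qed

subsection \<open>The argument of the Gamma factors\<close>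

text \<open>Digamma z is the limit of ln m minus the sum of 1 / (z + n) over n < m. The first terms,
  about Im z + |Re z| in number, have real part at most 1 / (2 Im z) by the arithmetic-geometric
  mean inequality; the later ones are compared with a telescoping logarithm that starts at ln (Im
  z).\<close>

lemma Re_Digamma_ge:
  fixes z :: complex
  assumes y: "Im z > 0"
  shows "Re (Digamma z) \<ge> ln (Im z) - (Im z + \<bar>Re z\<bar> + 2) / (2 * Im z)"
proof -
  define x y where "x = Re z" and "y = Im z"
  have y: "y > 0"
    using assms by (simp add: y_def)
  define d where "d = (\<lambda>n::nat. Re (inverse (z + of_nat n)))"
  have d_eq: "d n = (x + n) / ((x + n)\<^sup>2 + y\<^sup>2)" for n
    by (simp add: d_def x_def y_def)
  have d_le1: "d n \<le> 1 / (2 * y)" for n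
  proof -
    have "2 * y * (x + n) \<le> (x + n)\<^sup>2 + y\<^sup>2"
      using zero_le_power2[of "x + n - y"] by (simp add: power2_eq_square algebra_simps)
    moreover have "(x + n)\<^sup>2 + y\<^sup>2 > 0"
      using y by (simp add: add_nonneg_pos)
    ultimately show ?thesis
      unfolding d_eq using y by (simp add: field_simps)
  qed
  have d_le2: "d n \<le> 1 / (n - \<bar>x\<bar>)" if "n > \<bar>x\<bar>" for n
  proof -
    have pos: "x + n > 0"
      using that by linarith
    have "d n \<le> (x + n) / (x + n)\<^sup>2"
      unfolding d_eq using pos by (intro divide_left_mono mult_pos_pos add_pos_nonneg) auto
    also have "\<dots> = 1 / (x + n)"
      using pos by (simp add: power2_eq_square)
    also have "\<dots> \<le> 1 / (n - \<bar>x\<bar>)"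
      using that by (intro divide_left_mono mult_pos_pos) auto
    finally show ?thesis .
  qed
  \<comment> \<open>The switch between the two estimates: it makes
    \<open>p - \<bar>x\<bar> - 1\<close> at least \<open>y\<close>, so that the induction can start
    with the logarithmic terms contributing a nonnegative amount.\<close>
  define p where "p = nat \<lceil>y + \<bar>x\<bar> + 1\<rceil>"
  have p: "y + \<bar>x\<bar> + 1 \<le> p" "p \<le> y + \<bar>x\<bar> + 2"
    using y unfolding p_def by linarith+
  have sum_le: "(\<Sum>n<m. d n) \<le> p / (2 * y) + ln (m - \<bar>x\<bar> - 1) - ln y" if "m \<ge> p" for m
    using that
  proof (induction m rule: dec_induct)
    case base
    have "(\<Sum>n<p. d n) \<le> (\<Sum>n<p. 1 / (2 * y))"
      by (intro sum_mono d_le1)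
    moreover have "ln y \<le> ln (p - \<bar>x\<bar> - 1)"
      using p y by simp
    ultimately show ?case
      by simp
  next
    case (step m)
    define w where "w = m - \<bar>x\<bar> - 1"
    have w: "w > 0"
      using step p y unfolding w_def by linarith
    have "d m \<le> 1 / (w + 1)"
      using d_le2[of m] w by (simp add: w_def)
    \<comment> \<open>Passing from \<open>m\<close> to \<open>Suc m\<close> replaces
      \<open>w\<close> by \<open>w + 1\<close>, so these differences telescope.\<close>
    also have "\<dots> \<le> ln (w + 1) - ln w"
      using ln_diff_le[of w "w + 1"] w by (simp add: divide_minus_left)
    finally show ?case
      using step.IH by (simp add: w_def)
  qed
  have "ln y - p / (2 * y) \<le> ln (real m) - (\<Sum>n<m. d n)" if m: "m \<ge> p" for m
  proof -
    have "real m - \<bar>x\<bar> - 1 > 0"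
      using m p y by linarith
    then have "ln (real m - \<bar>x\<bar> - 1) \<le> ln (real m)"
      by simp
    then show ?thesis
      using sum_le[OF m] by linarith
  qed
  moreover have "(\<lambda>m. ln (real m) - (\<Sum>n<m. d n)) \<longlonglongrightarrow> Re (Digamma z)"
    using tendsto_Re[OF Digamma_LIMSEQ[of z]] assms by (cases "z = 0") (simp_all add: d_def)
  ultimately have "ln y - p / (2 * y) \<le> Re (Digamma z)"
    by (intro LIMSEQ_le_const) auto
  moreover have "p / (2 * y) \<le> (y + \<bar>x\<bar> + 2) / (2 * y)"
    using p y by (intro divide_right_mono) auto
  ultimately show ?thesis
    by (simp add: x_def y_def)
qed

text \<open>Imaginary parts of \<open>ln_Gamma\<close> are summed instead of taking
  \<open>Arg\<close> of the product: for positive \<open>\<alpha> i\<close> and t > 0 the arguments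
  avoid the cut of \<open>ln_Gamma\<close>, so this branch is differentiable.\<close>

definition gamma_phase :: "nat \<Rightarrow> (nat \<Rightarrow> real) \<Rightarrow> (nat \<Rightarrow> real) \<Rightarrow> real \<Rightarrow> real \<Rightarrow> real \<Rightarrow> real" where
  "gamma_phase k \<alpha> \<beta> lam \<delta> t =
     (\<Sum>i=1..k. Im (ln_Gamma (of_real (\<alpha> i) * Complex (\<delta> / 2) t + of_real (\<beta> i)))) - t * ln lam"

text \<open>Moving up a vertical line brings in the factor i, and Im (i w) = Re w; this is why only
  the real part of Digamma matters.\<close>

lemma Im_ln_Gamma_has_derivative:
  assumes "\<alpha> * t > 0"
  shows "((\<lambda>t. Im (ln_Gamma (of_real \<alpha> * Complex x t + of_real \<beta>))) has_real_derivative
    \<alpha> * Re (Digamma (of_real \<alpha> * Complex x t + of_real \<beta>))) (at t)"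
proof -
  have "of_real \<alpha> * Complex x t + of_real \<beta> \<notin> \<real>\<^sub>\<le>\<^sub>0"
    using assms by (auto simp: complex_nonpos_Reals_iff)
  moreover have "((\<lambda>t. of_real \<alpha> * Complex x t + of_real \<beta>) has_vector_derivative (\<i> * of_real \<alpha>)) (at t)"
    unfolding Complex_eq by (auto intro!: derivative_eq_intros simp: has_vector_derivative_def scaleR_conv_of_real)
  ultimately have "((\<lambda>t. ln_Gamma (of_real \<alpha> * Complex x t + of_real \<beta>)) has_vector_derivative
      (\<i> * of_real \<alpha>) * Digamma (of_real \<alpha> * Complex x t + of_real \<beta>)) (at t)"
    by (intro field_vector_diff_chain_at[where g = ln_Gamma, unfolded o_def] has_field_derivative_ln_Gamma_complex)
  then have "((\<lambda>t. Im (ln_Gamma (of_real \<alpha> * Complex x t + of_real \<beta>))) has_vector_derivative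
      Im ((\<i> * of_real \<alpha>) * Digamma (of_real \<alpha> * Complex x t + of_real \<beta>))) (at t)"
    by (rule bounded_linear.has_vector_derivative[OF bounded_linear_Im])
  then show ?thesis
    by (simp add: has_real_derivative_iff_has_vector_derivative)
qed

lemma gamma_phase_has_derivative:
  assumes \<alpha>: "\<forall>i\<in>{1..k}. \<alpha> i > 0" and t: "t > 0"
  shows "(gamma_phase k \<alpha> \<beta> lam \<delta> has_real_derivative
    (\<Sum>i=1..k. \<alpha> i * Re (Digamma (of_real (\<alpha> i) * Complex (\<delta> / 2) t + of_real (\<beta> i)))) - ln lam) (at t)"
proof -
  have "((\<lambda>t. t * ln lam) has_real_derivative ln lam) (at t)"
    by (auto intro!: derivative_eq_intros)
  moreover have "\<alpha> i * t > 0" if "i \<in> {1..k}" for i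
    using assms that by simp
  ultimately show ?thesis
    unfolding gamma_phase_def[abs_def] by (intro DERIV_diff DERIV_sum Im_ln_Gamma_has_derivative)
qed

lemma continuous_on_gamma_phase:
  assumes "\<forall>i\<in>{1..k}. \<alpha> i > 0" "X \<subseteq> {0<..}"
  shows "continuous_on X (gamma_phase k \<alpha> \<beta> lam \<delta>)"
proof (rule DERIV_continuous_on)
  fix t assume "t \<in> X"
  then have "t > 0"
    using assms(2) by auto
  then show "(gamma_phase k \<alpha> \<beta> lam \<delta> has_real_derivative
    (\<Sum>i=1..k. \<alpha> i * Re (Digamma (of_real (\<alpha> i) * Complex (\<delta> / 2) t + of_real (\<beta> i)))) - ln lam)
      (at t within X)"
    by (rule has_field_derivative_at_within[OF gamma_phase_has_derivative[OF assms(1)]])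
qed

text \<open>The derivative of A t ln t - B t is A (ln t + 1) - B. \<open>Re_Digamma_ge\<close>
  bounds the derivative of the phase below by this, so the difference of the two functions is
  nondecreasing.\<close>

lemma gamma_phase_growth:
  assumes \<alpha>: "\<forall>i\<in>{1..k}. \<alpha> i > 0"
  shows "\<exists>T>0. \<exists>B\<ge>0. \<forall>u v. T \<le> u \<longrightarrow> u \<le> v \<longrightarrow>
    gamma_phase k \<alpha> \<beta> lam \<delta> v - gamma_phase k \<alpha> \<beta> lam \<delta> u
      \<ge> (\<Sum>i=1..k. \<alpha> i) * (v * ln v - u * ln u) - B * (v - u)"
proof -
  define x where "x = (\<lambda>i. \<alpha> i * (\<delta> / 2) + \<beta> i)"
  define A where "A = (\<Sum>i=1..k. \<alpha> i)"
  \<comment> \<open>Ensures \<open>\<alpha> i * t \<ge> 1\<close> for every i once t >= T, which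
    keeps the correction term of \<open>Re_Digamma_ge\<close> bounded; the summand 1 keeps
    \<open>T\<close> positive.\<close>
  define T where "T = 1 + (\<Sum>i=1..k. 1 / \<alpha> i)"
  \<comment> \<open>The sum collects the constants of the Digamma bound, and the final
    \<open>A\<close> absorbs the 1 in (t ln t)' = ln t + 1.\<close>
  define B where "B = \<bar>(\<Sum>i=1..k. \<alpha> i * ((3 + \<bar>x i\<bar>) / 2 - ln (\<alpha> i)))\<bar> + \<bar>ln lam\<bar> + A"
  have A0: "A \<ge> 0"
    using \<alpha> unfolding A_def by (intro sum_nonneg) (auto simp: less_imp_le)
  have T_ge: "T \<ge> 1" "i \<in> {1..k} \<Longrightarrow> T \<ge> 1 / \<alpha> i" for i
  proof -
    have nn: "0 \<le> 1 / \<alpha> i" if "i \<in> {1..k}" for i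
      using \<alpha> that by (auto simp: less_imp_le)
    then show "T \<ge> 1"
      unfolding T_def using sum_nonneg[of "{1..k}" "\<lambda>i. 1 / \<alpha> i"] by simp
    show "T \<ge> 1 / \<alpha> i" if "i \<in> {1..k}"
      unfolding T_def using member_le_sum[of i "{1..k}" "\<lambda>i. 1 / \<alpha> i"] nn that by force
  qed
  have deriv_ge: "A * ln t + A - B \<le>
      (\<Sum>i=1..k. \<alpha> i * Re (Digamma (of_real (\<alpha> i) * Complex (\<delta> / 2) t + of_real (\<beta> i)))) - ln lam"
    if t: "t \<ge> T" for t
  proof -
    have t0: "t > 0"
      using t T_ge(1) by linarith
    have "(\<Sum>i=1..k. \<alpha> i * (ln t - ((3 + \<bar>x i\<bar>) / 2 - ln (\<alpha> i)))) \<le>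
      (\<Sum>i=1..k. \<alpha> i * Re (Digamma (of_real (\<alpha> i) * Complex (\<delta> / 2) t + of_real (\<beta> i))))"
    proof (rule sum_mono)
      fix i assume i: "i \<in> {1..k}"
      have a: "\<alpha> i > 0"
        using \<alpha> i by auto
      have at: "\<alpha> i * t \<ge> 1"
      proof -
        have "1 / \<alpha> i \<le> t"
          using T_ge(2)[OF i] t by linarith
        then show ?thesis
          using a by (simp add: field_simps)
      qed
      have "(w + \<bar>x i\<bar> + 2) / (2 * w) = 1 / 2 + (\<bar>x i\<bar> + 2) / (2 * w)" if "w \<ge> 1" for w :: real
        using that by (simp add: field_simps)
      from this[OF at] have "(\<alpha> i * t + \<bar>x i\<bar> + 2) / (2 * (\<alpha> i * t)) =
          1 / 2 + (\<bar>x i\<bar> + 2) / (2 * (\<alpha> i * t))" .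
      also have "\<dots> \<le> 1 / 2 + (\<bar>x i\<bar> + 2) / (2 * 1)"
        using at by (intro add_left_mono divide_left_mono) auto
      finally have "(\<alpha> i * t + \<bar>x i\<bar> + 2) / (2 * (\<alpha> i * t)) \<le> (3 + \<bar>x i\<bar>) / 2"
        by (simp add: field_simps)
      moreover have "ln (\<alpha> i * t) = ln (\<alpha> i) + ln t"
        using a t0 by (simp add: ln_mult)
      moreover have "ln (\<alpha> i * t) - (\<alpha> i * t + \<bar>x i\<bar> + 2) / (2 * (\<alpha> i * t)) \<le>
          Re (Digamma (of_real (\<alpha> i) * Complex (\<delta> / 2) t + of_real (\<beta> i)))"
        using Re_Digamma_ge[of "of_real (\<alpha> i) * Complex (\<delta> / 2) t + of_real (\<beta> i)"] a t0
        by (simp add: x_def)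
      ultimately have "ln t - ((3 + \<bar>x i\<bar>) / 2 - ln (\<alpha> i)) \<le>
          Re (Digamma (of_real (\<alpha> i) * Complex (\<delta> / 2) t + of_real (\<beta> i)))"
        by linarith
      then show "\<alpha> i * (ln t - ((3 + \<bar>x i\<bar>) / 2 - ln (\<alpha> i))) \<le>
          \<alpha> i * Re (Digamma (of_real (\<alpha> i) * Complex (\<delta> / 2) t + of_real (\<beta> i)))"
        using a by (intro mult_left_mono) auto
    qed
    moreover have "(\<Sum>i=1..k. \<alpha> i * (ln t - ((3 + \<bar>x i\<bar>) / 2 - ln (\<alpha> i)))) =
        A * ln t - (\<Sum>i=1..k. \<alpha> i * ((3 + \<bar>x i\<bar>) / 2 - ln (\<alpha> i)))"
      unfolding A_def sum_distrib_right sum_subtractf [symmetric]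
      by (rule sum.cong) (rule refl, rule right_diff_distrib)
    ultimately show ?thesis
      unfolding B_def by linarith
  qed
  have "A * (v * ln v - u * ln u) - B * (v - u)
      \<le> gamma_phase k \<alpha> \<beta> lam \<delta> v - gamma_phase k \<alpha> \<beta> lam \<delta> u" if u: "T \<le> u" "u \<le> v" for u v
  proof -
    define f where "f = (\<lambda>t. gamma_phase k \<alpha> \<beta> lam \<delta> t - A * (t * ln t) + B * t)"
    have "f u \<le> f v"
    proof (rule DERIV_nonneg_imp_nondecreasing[OF u(2)])
      fix t assume t: "u \<le> t" "t \<le> v"
      have t0: "t > 0"
        using t u T_ge(1) by linarith
      have "(f has_real_derivative
        (\<Sum>i=1..k. \<alpha> i * Re (Digamma (of_real (\<alpha> i) * Complex (\<delta> / 2) t + of_real (\<beta> i)))) - ln lam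
          - A * (ln t + 1) + B) (at t)"
        unfolding f_def using t0
        by (auto intro!: derivative_eq_intros gamma_phase_has_derivative[OF \<alpha>])
      moreover have "0 \<le> (\<Sum>i=1..k. \<alpha> i * Re (Digamma (of_real (\<alpha> i) * Complex (\<delta> / 2) t + of_real (\<beta> i))))
          - ln lam - A * (ln t + 1) + B"
        using deriv_ge[of t] t u by (simp add: algebra_simps)
      ultimately show "\<exists>y. (f has_real_derivative y) (at t) \<and> 0 \<le> y"
        by blast
    qed
    then show ?thesis
      by (simp add: f_def algebra_simps)
  qed
  moreover have "B \<ge> 0" "T > 0"
    using A0 T_ge unfolding B_def by auto
  ultimately show ?thesis
    unfolding A_def by blast
qed

subsection \<open>Truncated Dirichlet series and the critical line\<close>

lemma frequency_ge_1:
  fixes l :: "nat \<Rightarrow> real"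
  assumes "strict_mono_on {1..} l" "l 1 = 1" "n \<ge> 1"
  shows "l n \<ge> 1"
proof (cases "n = 1")
  case False
  then have "l 1 < l n"
    using assms by (intro strict_mono_onD[OF assms(1)]) auto
  then show ?thesis
    using assms(2) by simp
qed (use assms in simp)

lemma norm_dirichlet_term:
  assumes "l n > 0"
  shows "norm (dirichlet_term a l s n) = norm (a n) * l n powr (- Re s)"
  using assms
  by (simp add: dirichlet_term_def norm_divide norm_powr_real_powr powr_minus divide_inverse norm_mult norm_inverse)

lemma F_part_holomorphic:
  assumes l: "\<And>n. n \<ge> 1 \<Longrightarrow> l n > 0"
  shows "F_part a l N holomorphic_on X"
proof -
  have "l n \<noteq> 0" "of_real (l n) \<notin> (\<real>\<^sub>\<le>\<^sub>0 :: complex set)" if "n \<in> {1..N}" for n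
    using l[of n] that by (auto simp: complex_nonpos_Reals_iff)
  then show ?thesis
    unfolding F_part_def dirichlet_term_def powr_def
    by (intro holomorphic_intros) (auto intro!: holomorphic_intros)
qed

lemma F_part_cnj:
  assumes l: "\<And>n. n \<ge> 1 \<Longrightarrow> l n > 0" and a: "\<forall>n\<ge>1. a n \<in> \<real>"
  shows "F_part a l N (cnj s) = cnj (F_part a l N s)"
proof -
  have "dirichlet_term a l (cnj s) n = cnj (dirichlet_term a l s n)" if "n \<in> {1..N}" for n
  proof -
    have "cnj (of_real (l n) powr s) = of_real (l n) powr cnj s"
      using cnj_powr[of "of_real (l n)" s] l[of n] that by simp
    moreover have "cnj (a n) = a n"
      using a that by (simp add: Reals_cnj_iff)
    ultimately show ?thesis
      by (simp add: dirichlet_term_def)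
  qed
  then show ?thesis
    by (simp add: F_part_def)
qed

section \<open>Bounds for the truncated series, uniform in N\<close>

lemma weighted_partial_sum_le:
  fixes a :: "nat \<Rightarrow> complex" and l :: "nat \<Rightarrow> real"
  assumes l: "\<And>n. n \<ge> 1 \<Longrightarrow> l n > 0"
    and summ: "summable (\<lambda>n. norm (a (Suc n)) * l (Suc n) powr - \<sigma>)"
    and X: "X \<subseteq> {1..N}"
  shows "(\<Sum>n\<in>X. norm (a n) * l n powr - \<sigma>) \<le> (\<Sum>n. norm (a (Suc n)) * l (Suc n) powr - \<sigma>)"
proof -
  have "(\<Sum>n\<in>X. norm (a n) * l n powr - \<sigma>) \<le> (\<Sum>n\<in>{1..N}. norm (a n) * l n powr - \<sigma>)"
    using X by (intro sum_mono2) auto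
  also have "{1..N} = Suc ` {..<N}"
    by (simp only: lessThan_atLeast0 image_Suc_atLeastLessThan atLeastLessThanSuc_atLeastAtMost One_nat_def)
  also have "(\<Sum>n\<in>Suc ` {..<N}. norm (a n) * l n powr - \<sigma>) = (\<Sum>n<N. norm (a (Suc n)) * l (Suc n) powr - \<sigma>)"
    by (simp add: sum.reindex)
  also have "\<dots> \<le> (\<Sum>n. norm (a (Suc n)) * l (Suc n) powr - \<sigma>)"
    by (intro sum_le_suminf[OF summ]) auto
  finally show ?thesis .
qed

text \<open>Moving right by p multiplies the first nonzero term by l(m)^(-p) and each later term by
  at most l(m+1)^(-p), so for large p that term dominates the whole tail, whatever N is. It has
  index at most 2, hence occurs in every truncation with N >= 2.\<close>

lemma F_part_lower_bound:
  fixes a :: "nat \<Rightarrow> complex" and l :: "nat \<Rightarrow> real"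
  assumes l_mono: "strict_mono_on {1..} l" and l_1: "l 1 = 1" and a_2: "a 2 \<noteq> 0"
    and summ: "summable (\<lambda>n. norm (a (Suc n)) * l (Suc n) powr - \<sigma>)"
  shows "\<exists>\<sigma>\<^sub>1. \<exists>b>0. \<forall>N\<ge>2. \<forall>s. Re s = \<sigma>\<^sub>1 \<longrightarrow> b \<le> norm (F_part a l N s)"
proof -
  have l_less: "l m < l n" if "1 \<le> m" "m < n" for m n
    using l_mono that by (auto simp: strict_mono_on_def)
  have l_pos: "l n > 0" if "n \<ge> 1" for n
    using frequency_ge_1[OF l_mono l_1 that] by linarith
  define S where "S = (\<Sum>n. norm (a (Suc n)) * l (Suc n) powr - \<sigma>)"
  have S0: "S \<ge> 0"
    unfolding S_def by (intro suminf_nonneg summ) auto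
  \<comment> \<open>The leading term of the series: \<open>a 1\<close> is allowed to vanish.\<close>
  define m :: nat where "m = (if a 1 \<noteq> 0 then 1 else 2)"
  have m: "m \<ge> 1" "m \<le> 2" "a m \<noteq> 0" "\<And>n. n \<ge> 1 \<Longrightarrow> n < m \<Longrightarrow> a n = 0"
    using a_2 by (auto simp: m_def less_Suc_eq numeral_2_eq_2 split: if_splits)
  define q where "q = l m / l (Suc m)"
  have q: "0 < q" "q < 1"
    using l_pos[of m] l_pos[of "Suc m"] l_less[of m "Suc m"] m by (auto simp: q_def)
  define e where "e = norm (a m) * l m powr - \<sigma>"
  have e: "e > 0"
    using m l_pos[of m] by (simp add: e_def)
  \<comment> \<open>Makes the tail at most half the leading term; \<open>S + 1\<close> gives a
    positive denominator from \<open>S \<ge> 0\<close> alone.\<close>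
  obtain p where p: "q ^ p < e / (2 * (S + 1))"
    using real_arch_pow_inv[of "e / (2 * (S + 1))" q] q e S0 by auto
  have tail: "(\<Sum>n\<in>{Suc m..N}. norm (a n) * l n powr - (\<sigma> + p)) \<le> S * l (Suc m) powr - real p" for N
  proof -
    have "(\<Sum>n\<in>{Suc m..N}. norm (a n) * l n powr - (\<sigma> + p)) \<le>
      (\<Sum>n\<in>{Suc m..N}. norm (a n) * l n powr - \<sigma> * l (Suc m) powr - real p)"
    proof (rule sum_mono)
      fix n assume n: "n \<in> {Suc m..N}"
      have "l (Suc m) \<le> l n"
        using n l_less[of "Suc m" n] by (cases "n = Suc m") auto
      then have "l n powr - real p \<le> l (Suc m) powr - real p"
        using l_pos[of "Suc m"] by (intro powr_mono2') auto
      then show "norm (a n) * l n powr - (\<sigma> + p) \<le> norm (a n) * l n powr - \<sigma> * l (Suc m) powr - real p"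
        by (simp add: powr_add[of _ "- \<sigma>" "- real p", simplified] mult.assoc mult_left_mono)
    qed
    also have "\<dots> = (\<Sum>n\<in>{Suc m..N}. norm (a n) * l n powr - \<sigma>) * l (Suc m) powr - real p"
      by (simp add: sum_distrib_right)
    also have "\<dots> \<le> S * l (Suc m) powr - real p"
      unfolding S_def by (intro mult_right_mono weighted_partial_sum_le[of l a \<sigma> _ N] l_pos summ) auto
    finally show ?thesis .
  qed
  \<comment> \<open>Half the modulus of the leading term on the line Re s = \<sigma> + p.\<close>
  define b where "b = norm (a m) * l m powr - (\<sigma> + p) / 2"
  have b: "b > 0"
    using m l_pos[of m] by (simp add: b_def)
  have "S * l (Suc m) powr - real p \<le> b"
  proof -
    have "S * q ^ p \<le> (S + 1) * (e / (2 * (S + 1)))"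
      using p S0 q by (intro mult_mono) auto
    also have "\<dots> = e / 2"
      using S0 by (simp add: field_simps)
    finally have "S * q ^ p * l m powr - real p \<le> e / 2 * l m powr - real p"
      by (intro mult_right_mono) auto
    moreover have "q ^ p * l m powr - real p = l (Suc m) powr - real p"
      using l_pos[of m] l_pos[of "Suc m"] m
      by (simp add: q_def powr_minus powr_realpow power_divide field_simps)
    moreover have "e / 2 * l m powr - real p = b"
      by (simp add: e_def b_def powr_add[of _ "- \<sigma>" "- real p", simplified])
    ultimately show ?thesis
      by (simp add: mult.assoc)
  qed
  then have tail_b: "(\<Sum>n\<in>{Suc m..N}. norm (a n) * l n powr - (\<sigma> + p)) \<le> b" for N
    using tail order_trans by blast
  have "b \<le> norm (F_part a l N s)" if N: "N \<ge> 2" and s: "Re s = \<sigma> + p" for N s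
  proof -
    have split: "{1..N} = {1..<m} \<union> ({m} \<union> {Suc m..N})"
      using m N by auto
    have "F_part a l N s = (\<Sum>n\<in>{1..<m}. dirichlet_term a l s n) +
        (dirichlet_term a l s m + (\<Sum>n\<in>{Suc m..N}. dirichlet_term a l s n))"
      unfolding F_part_def split by (subst sum.union_disjoint; (subst sum.union_disjoint)?) auto
    also have "(\<Sum>n\<in>{1..<m}. dirichlet_term a l s n) = 0"
      using m(4) by (intro sum.neutral) (auto simp: dirichlet_term_def)
    finally have F_eq: "F_part a l N s = dirichlet_term a l s m + (\<Sum>n\<in>{Suc m..N}. dirichlet_term a l s n)"
      by simp
    have "norm (\<Sum>n\<in>{Suc m..N}. dirichlet_term a l s n) \<le> (\<Sum>n\<in>{Suc m..N}. norm (dirichlet_term a l s n))"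
      by (rule norm_sum)
    also have "\<dots> = (\<Sum>n\<in>{Suc m..N}. norm (a n) * l n powr - (\<sigma> + p))"
      by (intro sum.cong refl) (use l_pos s in \<open>auto simp: norm_dirichlet_term\<close>)
    also have "\<dots> \<le> b"
      by (rule tail_b)
    finally have "norm (\<Sum>n\<in>{Suc m..N}. dirichlet_term a l s n) \<le> b" .
    moreover have "norm (dirichlet_term a l s m) = 2 * b"
      using l_pos m s by (simp add: norm_dirichlet_term b_def)
    ultimately show ?thesis
      unfolding F_eq using norm_triangle_ineq2[of "dirichlet_term a l s m" "- (\<Sum>n\<in>{Suc m..N}. dirichlet_term a l s n)"]
      by simp
  qed
  then show ?thesis
    using b by blast
qed

text \<open>Since frequencies are at least 1, passing from the abscissa \<sigma> to any point of the
  strip costs each term at most a factor l(N)^D, which is polynomial in N. A bound that is a pure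
  power of N has a logarithm proportional to ln N.\<close>

lemma F_part_upper_bound:
  fixes a :: "nat \<Rightarrow> complex" and l :: "nat \<Rightarrow> real"
  assumes l_mono: "strict_mono_on {1..} l" and l_1: "l 1 = 1"
    and l_growth: "\<exists>K c. \<forall>n\<ge>1. l n \<le> K * real n powr c"
    and summ: "summable (\<lambda>n. norm (a (Suc n)) * l (Suc n) powr - \<sigma>)"
  shows "\<exists>C\<ge>0. \<forall>N\<ge>2. \<forall>s. \<bar>Re s\<bar> \<le> B \<longrightarrow> norm (F_part a l N s) \<le> real N powr C"
proof -
  have l_le: "l m \<le> l n" if "1 \<le> m" "m \<le> n" for m n
    using l_mono that by (cases "m = n") (auto simp: strict_mono_on_def intro: less_imp_le)
  have l_ge: "l n \<ge> 1" if "n \<ge> 1" for n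
    by (rule frequency_ge_1[OF l_mono l_1 that])
  have l_pos: "l n > 0" if "n \<ge> 1" for n
    using l_ge[OF that] by linarith
  define S where "S = (\<Sum>n. norm (a (Suc n)) * l (Suc n) powr - \<sigma>)"
  obtain K c where Kc: "\<And>n. n \<ge> 1 \<Longrightarrow> l n \<le> K * real n powr c"
    using l_growth by blast
  have K: "K \<ge> 1"
    using Kc[of 1] l_1 by simp
  define D where "D = \<bar>\<sigma>\<bar> + \<bar>B\<bar>"
  define W where "W = max 1 (S * K powr D)"
  \<comment> \<open>The constant factor is absorbed through W = 2^(log 2 W) <= N^(log 2 W), valid
    because N >= 2 and W >= 1.\<close>
  define C where "C = log 2 W + \<bar>c\<bar> * D"
  have "C \<ge> 0"
    unfolding C_def W_def D_def by (intro add_nonneg_nonneg mult_nonneg_nonneg) auto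
  moreover have "norm (F_part a l N s) \<le> real N powr C" if N: "N \<ge> 2" and s: "\<bar>Re s\<bar> \<le> B" for N s
  proof -
    have "norm (F_part a l N s) \<le> (\<Sum>n\<in>{1..N}. norm (dirichlet_term a l s n))"
      unfolding F_part_def by (rule norm_sum)
    also have "\<dots> \<le> (\<Sum>n\<in>{1..N}. norm (a n) * l n powr - \<sigma> * l N powr D)"
    proof (rule sum_mono)
      fix n assume n: "n \<in> {1..N}"
      have "l n powr (\<sigma> - Re s) \<le> l n powr D"
        using l_ge[of n] n s by (intro powr_mono) (auto simp: D_def)
      also have "\<dots> \<le> l N powr D"
        using l_le[of n N] l_pos[of n] n by (intro powr_mono2) (auto simp: D_def)
      finally have "norm (a n) * l n powr - \<sigma> * l n powr (\<sigma> - Re s) \<le> norm (a n) * l n powr - \<sigma> * l N powr D"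
        by (intro mult_left_mono) auto
      then show "norm (dirichlet_term a l s n) \<le> norm (a n) * l n powr - \<sigma> * l N powr D"
        using l_pos[of n] n by (simp add: norm_dirichlet_term mult.assoc powr_add [symmetric])
    qed
    also have "\<dots> = (\<Sum>n\<in>{1..N}. norm (a n) * l n powr - \<sigma>) * l N powr D"
      by (simp add: sum_distrib_right)
    also have "\<dots> \<le> S * l N powr D"
      unfolding S_def by (intro mult_right_mono weighted_partial_sum_le[of l a \<sigma> _ N] l_pos summ) auto
    also have "\<dots> \<le> S * (K * real N powr \<bar>c\<bar>) powr D"
    proof -
      have "l N \<le> K * real N powr c"
        using Kc N by simp
      also have "\<dots> \<le> K * real N powr \<bar>c\<bar>"
        using N K by (intro mult_left_mono powr_mono) auto
      finally have "l N powr D \<le> (K * real N powr \<bar>c\<bar>) powr D"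
        using l_pos[of N] N by (intro powr_mono2) (auto simp: D_def)
      moreover have "S \<ge> 0"
        unfolding S_def by (intro suminf_nonneg summ) auto
      ultimately show ?thesis
        by (intro mult_left_mono)
    qed
    also have "\<dots> = S * K powr D * real N powr (\<bar>c\<bar> * D)"
      using K by (simp add: powr_mult powr_powr)
    also have "\<dots> \<le> W * real N powr (\<bar>c\<bar> * D)"
      unfolding W_def by (intro mult_right_mono) auto
    also have "W \<le> real N powr log 2 W"
    proof -
      have "W = 2 powr log 2 W"
        by (simp add: W_def)
      also have "\<dots> \<le> real N powr log 2 W"
        using N by (intro powr_mono2) (auto simp: W_def)
      finally show ?thesis .
    qed
    then have "W * real N powr (\<bar>c\<bar> * D) \<le> real N powr log 2 W * real N powr (\<bar>c\<bar> * D)"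
      by (intro mult_right_mono) auto
    also have "\<dots> = real N powr C"
      by (simp add: C_def powr_add)
    finally show ?thesis .
  qed
  ultimately show ?thesis
    by blast
qed

section \<open>Reflection and phases on the critical line\<close>

lemma critical_line_reflection: "of_real \<delta> - Complex (\<delta> / 2) t = cnj (Complex (\<delta> / 2) t)"
  by (simp add: complex_eq_iff)

lemma Omega_cnj: "Omega k \<alpha> \<beta> (cnj s) = cnj (Omega k \<alpha> \<beta> s)"
  by (simp add: Omega_def cnj_Gamma)

lemma Gamma_argument_not_real:
  assumes "(\<alpha>::real) > 0" "Im s \<noteq> 0"
  shows "of_real \<alpha> * s + of_real \<beta> \<notin> \<int>\<^sub>\<le>\<^sub>0"
proof
  assume "of_real \<alpha> * s + of_real \<beta> \<in> \<int>\<^sub>\<le>\<^sub>0"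
  then obtain n where "of_real \<alpha> * s + of_real \<beta> = of_int n"
    by (elim nonpos_Ints_cases)
  then have "Im (of_real \<alpha> * s + of_real \<beta>) = 0"
    by (metis Im_complex_of_real of_real_of_int_eq)
  then show False
    using assms by simp
qed

lemma Omega_holomorphic:
  assumes \<alpha>: "\<forall>i\<in>{1..k}. \<alpha> i > 0" and f: "f holomorphic_on X" "\<And>s. s \<in> X \<Longrightarrow> Im (f s) \<noteq> 0"
  shows "(\<lambda>s. Omega k \<alpha> \<beta> (f s)) holomorphic_on X"
  unfolding Omega_def
  by (intro holomorphic_intros f Gamma_argument_not_real) (use \<alpha> f(2) in auto)

lemma Omega_nonzero:
  assumes "\<forall>i\<in>{1..k}. \<alpha> i > 0" "Im s \<noteq> 0"
  shows "Omega k \<alpha> \<beta> s \<noteq> 0"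
proof -
  have "of_real (\<alpha> i) * s + of_real (\<beta> i) \<notin> \<int>\<^sub>\<le>\<^sub>0" if "i \<in> {1..k}" for i
    by (rule Gamma_argument_not_real) (use assms that in auto)
  then show ?thesis
    by (auto simp: Omega_def Gamma_eq_zero_iff)
qed

lemma zeta_part_holomorphic:
  assumes l: "\<And>n. n \<ge> 1 \<Longrightarrow> l n > 0" and \<alpha>: "\<forall>i\<in>{1..k}. \<alpha> i > 0" and lam: "lam > 0"
  shows "zeta_part a l k \<alpha> \<beta> lam \<delta> N holomorphic_on {s. Im s > 0}"
proof -
  have "(\<lambda>s. F_part a l N (of_real \<delta> - s)) holomorphic_on {s. Im s > 0}"
    by (rule holomorphic_on_compose_gen[OF _ F_part_holomorphic[OF l, where X = UNIV], unfolded o_def])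
       (auto intro!: holomorphic_intros)
  then show ?thesis
    unfolding zeta_part_def[abs_def] G_factor_def
    by (intro holomorphic_intros F_part_holomorphic Omega_holomorphic[OF \<alpha>] l Omega_nonzero[OF \<alpha>])
       (use lam in \<open>auto simp: Omega_nonzero[OF \<alpha>]\<close>)
qed

text \<open>Here \<delta> - s is the conjugate of s, so the quotient of the Gamma products is exp
  (cnj L - L) with exp L = \<Omega>(s), while the exponent 2s - \<delta> is purely imaginary. Both
  factors are therefore pure phases.\<close>

lemma G_factor_critical_line:
  assumes \<alpha>: "\<forall>i\<in>{1..k}. \<alpha> i > 0" and lam: "lam > 0" and t: "t > 0"
  shows "G_factor k \<alpha> \<beta> lam \<delta> (Complex (\<delta> / 2) t) = cis (- 2 * gamma_phase k \<alpha> \<beta> lam \<delta> t)"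
proof -
  define s where "s = Complex (\<delta> / 2) t"
  define L where "L = (\<Sum>i=1..k. ln_Gamma (of_real (\<alpha> i) * s + of_real (\<beta> i)))"
  have "of_real (\<alpha> i) * s + of_real (\<beta> i) \<notin> \<int>\<^sub>\<le>\<^sub>0" if "i \<in> {1..k}" for i
    by (rule Gamma_argument_not_real) (use \<alpha> t that in \<open>auto simp: s_def\<close>)
  then have "Omega k \<alpha> \<beta> s = exp L"
    unfolding Omega_def L_def exp_sum[OF finite_atLeastAtMost]
    by (intro prod.cong refl) (simp add: Gamma_complex_altdef)
  then have "Omega k \<alpha> \<beta> (of_real \<delta> - s) / Omega k \<alpha> \<beta> s = exp (cnj L - L)"
    unfolding s_def critical_line_reflection by (simp add: Omega_cnj exp_cnj exp_diff)
  also have "cnj L - L = \<i> * of_real (- 2 * Im L)"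
    by (simp add: complex_eq_iff)
  finally have Om: "Omega k \<alpha> \<beta> (of_real \<delta> - s) / Omega k \<alpha> \<beta> s = cis (- 2 * Im L)"
    by (simp add: cis_conv_exp)
  have "2 * s - of_real \<delta> = \<i> * of_real (2 * t)"
    by (simp add: s_def complex_eq_iff)
  then have "of_real lam powr (2 * s - of_real \<delta>) = cis (2 * t * ln lam)"
    using lam by (simp add: powr_def Ln_of_real cis_conv_exp mult_ac)
  then have "G_factor k \<alpha> \<beta> lam \<delta> s = cis (2 * t * ln lam + - 2 * Im L)"
    unfolding G_factor_def Om by (simp only: cis_mult)
  also have "2 * t * ln lam + - 2 * Im L = - 2 * gamma_phase k \<alpha> \<beta> lam \<delta> t"
    by (simp add: gamma_phase_def L_def s_def)
  finally show ?thesis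
    by (simp only: s_def)
qed

text \<open>Factoring out exp (-i \<theta>) leaves q times 2 cos (\<theta> + \<phi>). Reality of the
  coefficients enters through \<open>F_part_cnj\<close>, which gives the reflected sum the opposite
  phase.\<close>

lemma zeta_part_eq_zero_if_cos_zero:
  assumes l: "\<And>n. n \<ge> 1 \<Longrightarrow> l n > 0" and \<alpha>: "\<forall>i\<in>{1..k}. \<alpha> i > 0" and lam: "lam > 0"
    and a: "\<forall>n\<ge>1. a n \<in> \<real>" and t: "t > 0"
    and F: "F_part a l N (Complex (\<delta> / 2) t) = of_real q * cis \<phi>"
    and cos: "cos (gamma_phase k \<alpha> \<beta> lam \<delta> t + \<phi>) = 0"
  shows "zeta_part a l k \<alpha> \<beta> lam \<delta> N (Complex (\<delta> / 2) t) = 0"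
proof -
  define \<theta> where "\<theta> = gamma_phase k \<alpha> \<beta> lam \<delta> t"
  have "F_part a l N (of_real \<delta> - Complex (\<delta> / 2) t) = of_real q * cis (- \<phi>)"
    using F_part_cnj[of l a N "Complex (\<delta> / 2) t"] l a F
    by (simp add: critical_line_reflection cis_cnj)
  then have "zeta_part a l k \<alpha> \<beta> lam \<delta> N (Complex (\<delta> / 2) t) =
      of_real q * (cis \<phi> + cis (- 2 * \<theta>) * cis (- \<phi>))"
    unfolding zeta_part_def G_factor_critical_line[OF \<alpha> lam t] F \<theta>_def by (simp add: algebra_simps)
  also have "cis \<phi> + cis (- 2 * \<theta>) * cis (- \<phi>) = cis (- \<theta>) * (cis (\<theta> + \<phi>) + cis (- (\<theta> + \<phi>)))"
    by (simp add: cis_mult distrib_left)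
  also have "cis (\<theta> + \<phi>) + cis (- (\<theta> + \<phi>)) = 0"
    using cos cos_minus[of "\<theta> + \<phi>"] sin_minus[of "\<theta> + \<phi>"]
    by (simp only: complex_eq_iff cis.sel plus_complex.sel zero_complex.sel \<theta>_def) simp
  finally show ?thesis
    by simp
qed

subsection \<open>Counting zeros\<close>

text \<open>The substitution z -> x + i z turns the vertical segment into a real one, to which
  \<open>phase_on_real_segment\<close> applies. Both bounds on the truncated series are independent
  of the height, so \<open>D\<close> serves all unit intervals.\<close>

lemma F_part_phase:
  fixes a :: "nat \<Rightarrow> complex" and l :: "nat \<Rightarrow> real" and x :: real
  assumes l_mono: "strict_mono_on {1..} l" and l_1: "l 1 = 1" and a_2: "a 2 \<noteq> 0"
    and l_growth: "\<exists>K c. \<forall>n\<ge>1. l n \<le> K * real n powr c"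
    and summ: "summable (\<lambda>n. norm (a (Suc n)) * l (Suc n) powr - \<sigma>)"
  shows "\<exists>D\<ge>0. \<forall>N\<ge>2. \<forall>u v. u \<le> v \<longrightarrow> v \<le> u + 1 \<longrightarrow>
    (\<exists>q \<phi> :: real \<Rightarrow> real. continuous_on {u..v} \<phi> \<and>
      (\<forall>t\<in>{u..v}. F_part a l N (Complex x t) = of_real (q t) * cis (\<phi> t)) \<and>
      \<bar>\<phi> v - \<phi> u\<bar> \<le> D * ln (real N))"
proof -
  have l_pos: "l n > 0" if "n \<ge> 1" for n
    using frequency_ge_1[OF l_mono l_1 that] by linarith
  obtain \<sigma>\<^sub>1 b where b: "b > 0" "\<And>N s. N \<ge> 2 \<Longrightarrow> Re s = \<sigma>\<^sub>1 \<Longrightarrow> b \<le> norm (F_part a l N s)"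
    using F_part_lower_bound[OF l_mono l_1 a_2 summ] by blast
  \<comment> \<open>\<open>r / 2\<close> bounds the distance from the centre, on Re s =
    \<open>\<sigma>\<^sub>1\<close>, to any point of the segment.\<close>
  define r where "r = 2 * (\<bar>\<sigma>\<^sub>1 - x\<bar> + 1)"
  have r: "r > 0"
    unfolding r_def by (intro mult_pos_pos add_nonneg_pos) auto
  define B where "B = \<bar>\<sigma>\<^sub>1\<bar> + 3 * r"
  obtain C where C: "C \<ge> 0" "\<And>N s. N \<ge> 2 \<Longrightarrow> \<bar>Re s\<bar> \<le> B \<Longrightarrow> norm (F_part a l N s) \<le> real N powr C"
    using F_part_upper_bound[OF l_mono l_1 l_growth summ, of B] by blast
  define E where "E = \<bar>1 - ln b\<bar>"
  \<comment> \<open>Dividing by ln 2 turns the constant \<open>E\<close> into a multiple of ln N, as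
    N >= 2.\<close>
  define D where "D = 16 * (C + E / ln 2)"
  have "D \<ge> 0"
    unfolding D_def E_def using C(1) by simp
  moreover have "\<exists>q \<phi> :: real \<Rightarrow> real. continuous_on {u..v} \<phi> \<and>
      (\<forall>t\<in>{u..v}. F_part a l N (Complex x t) = of_real (q t) * cis (\<phi> t)) \<and>
      \<bar>\<phi> v - \<phi> u\<bar> \<le> D * ln (real N)"
    if N: "N \<ge> 2" and uv: "u \<le> v" "v \<le> u + 1" for N u v
  proof -
    define P where "P = (\<lambda>z. F_part a l N (of_real x + \<i> * z))"
    \<comment> \<open>Its image x + i c is \<open>\<sigma>\<^sub>1\<close> + i u, a point where the
      lower bound holds.\<close>
    define c where "c = Complex u (x - \<sigma>\<^sub>1)"
    have holP: "P holomorphic_on UNIV"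
      unfolding P_def
      by (rule holomorphic_on_compose_gen[OF _ F_part_holomorphic[OF l_pos, where X = UNIV], unfolded o_def])
         (auto intro!: holomorphic_intros)
    have Pc: "b \<le> norm (P c)"
      unfolding P_def by (rule b(2)[OF N]) (simp add: c_def)
    have P_le: "norm (P z) \<le> real N powr C" if z: "z \<in> cball c (3 * r)" for z
      unfolding P_def
    proof (rule C(2)[OF N])
      have "\<bar>Im (z - c)\<bar> \<le> 3 * r"
        using abs_Im_le_cmod[of "z - c"] z by (simp add: dist_norm norm_minus_commute)
      then show "\<bar>Re (of_real x + \<i> * z)\<bar> \<le> B"
        by (simp add: c_def B_def)
    qed
    have seg: "of_real ` {u..v} \<subseteq> cball c (r / 2)"
    proof safe
      fix t assume t: "t \<in> {u..v}"
      have "norm (c - of_real t) \<le> \<bar>Re (c - of_real t)\<bar> + \<bar>Im (c - of_real t)\<bar>"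
        by (rule cmod_le)
      also have "\<dots> = (t - u) + \<bar>\<sigma>\<^sub>1 - x\<bar>"
        using t by (simp add: c_def abs_minus_commute)
      also have "\<dots> \<le> 1 + \<bar>\<sigma>\<^sub>1 - x\<bar>"
        using t uv by simp
      also have "\<dots> = r / 2"
        by (simp add: r_def)
      finally show "of_real t \<in> cball c (r / 2)"
        by (simp add: dist_norm)
    qed
    have Pc_nz: "P c \<noteq> 0"
      using Pc b by auto
    obtain q \<phi> :: "real \<Rightarrow> real" where \<phi>: "continuous_on {u..v} \<phi>"
      "\<And>t. t \<in> {u..v} \<Longrightarrow> P (of_real t) = of_real (q t) * cis (\<phi> t)"
      "\<And>y z. y \<in> {u..v} \<Longrightarrow> z \<in> {u..v} \<Longrightarrow> \<bar>\<phi> y - \<phi> z\<bar> \<le> 16 * (1 + ln (real N powr C / norm (P c)))"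
      using phase_on_real_segment[OF r open_UNIV subset_UNIV holP P_le Pc_nz seg] by blast
    have "1 + ln (real N powr C / norm (P c)) = C * ln (real N) + (1 - ln (norm (P c)))"
      using N Pc_nz by (simp add: ln_div ln_powr)
    moreover have "1 - ln (norm (P c)) \<le> E"
    proof -
      have "ln b \<le> ln (norm (P c))"
        using Pc b(1) Pc_nz by simp
      then show ?thesis
        by (simp add: E_def)
    qed
    moreover have "E \<le> E / ln 2 * ln (real N)"
    proof -
      have "E / ln 2 * ln 2 \<le> E / ln 2 * ln (real N)"
        using N by (intro mult_left_mono) (auto simp: E_def)
      then show ?thesis
        by simp
    qed
    ultimately have "1 + ln (real N powr C / norm (P c)) \<le> C * ln (real N) + E / ln 2 * ln (real N)"
      by linarith
    then have "16 * (1 + ln (real N powr C / norm (P c))) \<le> 16 * (C * ln (real N) + E / ln 2 * ln (real N))"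
      by (intro mult_left_mono) auto
    also have "\<dots> = D * ln (real N)"
      by (simp add: D_def algebra_simps)
    finally have "\<bar>\<phi> v - \<phi> u\<bar> \<le> D * ln (real N)"
      using order_trans[OF \<phi>(3)[of v u]] uv by simp
    moreover have "F_part a l N (Complex x t) = P (of_real t)" for t
      by (simp add: P_def Complex_eq)
    ultimately show ?thesis
      using \<phi>(1,2) by - (rule exI[of _ q], rule exI[of _ \<phi>], auto)
  qed
  ultimately show ?thesis
    by blast
qed

text \<open>The phase of the truncated series is chosen afresh on each unit interval, so only
  \<theta> telescopes while the counts and losses add up. Zeros at the junctions are dropped, which
  is harmless for a lower bound. Finiteness is carried along because \<open>card\<close> of an
  infinite set is 0.\<close>

lemma card_ge_sum_over_unit_steps:
  fixes Z :: "real set" and \<theta> :: "real \<Rightarrow> real"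
  assumes step: "\<And>u v. T \<le> u \<Longrightarrow> u \<le> v \<Longrightarrow> v \<le> u + 1 \<Longrightarrow> finite {t\<in>Z. u < t \<and> t < v} \<Longrightarrow>
      \<theta> v - \<theta> u - D \<le> card {t\<in>Z. u < t \<and> t < v}"
    and "D \<ge> 0" "T \<le> u" "u \<le> v" "v \<le> u + real n" "finite {t\<in>Z. u < t \<and> t < v}"
  shows "\<theta> v - \<theta> u - real n * D \<le> card {t\<in>Z. u < t \<and> t < v}"
  using assms(3-)
proof (induction n arbitrary: u)
  case (Suc n)
  show ?case
  proof (cases "v \<le> u + 1")
    case True
    have "D \<le> real (Suc n) * D"
      using \<open>D \<ge> 0\<close> by (simp add: algebra_simps)
    then show ?thesis
      using step[of u v] Suc.prems True by linarith
  next
    case False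
    let ?A = "{t\<in>Z. u < t \<and> t < u + 1}" and ?B = "{t\<in>Z. u + 1 < t \<and> t < v}"
    have sub: "?A \<union> ?B \<subseteq> {t\<in>Z. u < t \<and> t < v}"
      using False by auto
    have fin: "finite ?A" "finite ?B"
      using finite_subset[OF sub] Suc.prems by auto
    have "\<theta> (u + 1) - \<theta> u - D \<le> card ?A"
      using step[of u "u + 1"] Suc.prems fin by simp
    moreover have "\<theta> v - \<theta> (u + 1) - real n * D \<le> card ?B"
      using Suc.IH[of "u + 1"] Suc.prems fin False by simp
    moreover have "card ?A + card ?B \<le> card {t\<in>Z. u < t \<and> t < v}"
    proof -
      have "?A \<inter> ?B = {}"
        by auto
      then show ?thesis
        using card_mono[OF _ sub] card_Un_disjoint[OF fin] Suc.prems by simp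
    qed
    ultimately show ?thesis
      by (simp add: algebra_simps)
  qed
qed simp

text \<open>Nonvanishing at the lower endpoint excludes f = 0 identically on the connected set
  \<open>S\<close>. Zeros are then isolated, finitely many lie on the compact segment, and each has
  order at least 1.\<close>

lemma card_zeros_le_zeros_on_line:
  assumes S: "open S" "connected S" and hol: "f holomorphic_on S"
    and seg: "\<And>t. T \<le> t \<Longrightarrow> t \<le> T + U \<Longrightarrow> Complex c t \<in> S"
    and U: "U > 0" and nz: "f (Complex c T) \<noteq> 0"
  shows "finite {t. T < t \<and> t < T + U \<and> f (Complex c t) = 0}"
    and "int (card {t. T < t \<and> t < T + U \<and> f (Complex c t) = 0}) \<le> zeros_on_line f c T U"
proof -
  define Y where "Y = {t. T < t \<and> t < T + U \<and> f (Complex c t) = 0}"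
  define Z where "Z = {z. Re z = c \<and> T < Im z \<and> Im z < T + U \<and> f z = 0}"
  define K where "K = Complex c ` {T..T + U}"
  have K: "compact K" "K \<subseteq> S"
    unfolding K_def Complex_eq using seg
    by (auto intro!: compact_continuous_image continuous_intros simp: Complex_eq)
  have Z_sub: "Z \<subseteq> {z\<in>K. f z = 0}"
  proof
    fix z assume "z \<in> Z"
    then show "z \<in> {z\<in>K. f z = 0}"
      unfolding Z_def K_def by (cases z) auto
  qed
  have finZ: "finite Z"
  \<comment> \<open>The finiteness result for zeros concerns nonconstant functions; a constant f is
    nonzero by \<open>nz\<close>.\<close>
  proof (cases "f constant_on S")
    case True
    then obtain y where "\<And>z. z \<in> S \<Longrightarrow> f z = y"
      unfolding constant_on_def by blast
    moreover have "Complex c T \<in> S"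
      using seg[of T] U by simp
    ultimately have "Z = {}"
      using Z_sub K nz by fastforce
    then show ?thesis
      by simp
  next
    case False
    then show ?thesis
      using holomorphic_compact_finite_zeros[OF hol S K] Z_sub finite_subset by blast
  qed
  have Z_eq: "Z = Complex c ` Y"
  proof
    show "Z \<subseteq> Complex c ` Y"
    proof
      fix z assume "z \<in> Z"
      then show "z \<in> Complex c ` Y"
        unfolding Z_def Y_def by (cases z) auto
    qed
  qed (auto simp: Z_def Y_def)
  have inj: "inj_on (Complex c) Y"
    by (rule inj_onI) simp
  show "finite {t. T < t \<and> t < T + U \<and> f (Complex c t) = 0}"
    using finZ inj unfolding Z_eq Y_def by (simp add: finite_image_iff)
  have "1 \<le> zorder f z" if z: "z \<in> Z" for z
  proof -
    have zS: "z \<in> S" and fz: "f z = 0"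
      using z Z_sub K by auto
    have "Complex c T \<in> S"
      using seg[of T] U by simp
    then have "\<forall>\<^sub>F w in at z. f w \<noteq> 0 \<and> w \<in> S"
      using non_zero_neighbour_alt[OF hol S zS _ nz] by simp
    then have "\<forall>\<^sub>F w in at z. f w \<noteq> 0"
      by (rule eventually_mono) simp
    then have "\<exists>\<^sub>F w in at z. f w \<noteq> 0"
      by (intro eventually_frequently) auto
    then show ?thesis
      using zorder_pos_iff[OF hol S(1) zS] fz by simp
  qed
  then have "(\<Sum>z\<in>Z. 1) \<le> (\<Sum>z\<in>Z. zorder f z)"
    by (intro sum_mono)
  moreover have "card Z = card Y"
    unfolding Z_eq by (rule card_image[OF inj])
  ultimately show "int (card {t. T < t \<and> t < T + U \<and> f (Complex c t) = 0}) \<le> zeros_on_line f c T U"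
    by (simp add: zeros_on_line_def Z_def Y_def)
qed

text \<open>The error has \<open>max 1 U\<close> in place of U: if A > 0, a short zero-free interval
  at large height has main term about (A / pi) U ln T, beyond any fixed multiple of U ln N.
  Uniformity is expressed by choosing \<open>T\<^sub>0\<close> and \<open>C\<close> before N, U and
  T.\<close>

theorem theorem1p6:
  fixes F :: "complex \<Rightarrow> complex"
    and a :: "nat \<Rightarrow> complex" and l :: "nat \<Rightarrow> real"
    and k :: nat and \<alpha> \<beta> :: "nat \<Rightarrow> real"
    and lam \<delta> \<sigma>\<^sub>0 :: real
  assumes l_mono: "strict_mono_on {1..} l"
    and l_1: "l 1 = 1"
    and a_2: "a 2 \<noteq> 0"
    and a_3: "a 3 \<noteq> 0"
    and a_growth: "\<exists>K c. \<forall>n\<ge>1. norm (a n) \<le> K * real n powr c"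
    and l_growth: "\<exists>K c. \<forall>n\<ge>1. l n \<le> K * real n powr c"
    and F: "continues_dirichlet_series F a l \<sigma>\<^sub>0"
    and fe: "functional_equation F k \<alpha> \<beta> lam \<delta>"
    and lam: "lam > 0"
    and \<alpha>: "\<forall>i\<in>{1..k}. \<alpha> i > 0"
    and a_real: "\<forall>n\<ge>1. a n \<in> \<real>"
  shows "\<exists>T\<^sub>0>0. \<exists>C. \<forall>N\<ge>2. \<forall>U>0. \<forall>T\<ge>T\<^sub>0.
           zeta_part a l k \<alpha> \<beta> lam \<delta> N (Complex (\<delta> / 2) T) \<noteq> 0 \<longrightarrow>
           zeta_part a l k \<alpha> \<beta> lam \<delta> N (Complex (\<delta> / 2) (T + U)) \<noteq> 0 \<longrightarrow>
           real_of_int (zeros_on_line (zeta_part a l k \<alpha> \<beta> lam \<delta> N) (\<delta> / 2) T U)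
             \<ge> (\<Sum>i=1..k. \<alpha> i) / pi * ((T + U) * ln (T + U) - T * ln T)
                - C * (max 1 U * ln (real N))"
proof -
  define \<theta> where "\<theta> = gamma_phase k \<alpha> \<beta> lam \<delta>"
  define A where "A = (\<Sum>i=1..k. \<alpha> i)"
  have l_pos: "l n > 0" if "n \<ge> 1" for n
    using frequency_ge_1[OF l_mono l_1 that] by linarith
  have summ: "summable (\<lambda>n. norm (a (Suc n)) * l (Suc n) powr - (\<sigma>\<^sub>0 + 1))"
  proof -
    have "summable (\<lambda>n. norm (dirichlet_term a l (of_real (\<sigma>\<^sub>0 + 1)) (Suc n)))"
      using F unfolding continues_dirichlet_series_def by simp
    then show ?thesis
      by (simp add: norm_dirichlet_term l_pos)
  qed
  obtain T\<^sub>0 B where T0: "T\<^sub>0 > 0" and B: "B \<ge> 0"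
    "\<And>u v. T\<^sub>0 \<le> u \<Longrightarrow> u \<le> v \<Longrightarrow> A * (v * ln v - u * ln u) - B * (v - u) \<le> \<theta> v - \<theta> u"
    using gamma_phase_growth[OF \<alpha>, of \<beta> lam \<delta>] unfolding \<theta>_def A_def by blast
  obtain D where D: "D \<ge> 0" "\<And>N u v. N \<ge> 2 \<Longrightarrow> u \<le> v \<Longrightarrow> v \<le> u + 1 \<Longrightarrow>
      \<exists>q \<phi> :: real \<Rightarrow> real. continuous_on {u..v} \<phi> \<and>
        (\<forall>t\<in>{u..v}. F_part a l N (Complex (\<delta> / 2) t) = of_real (q t) * cis (\<phi> t)) \<and>
        \<bar>\<phi> v - \<phi> u\<bar> \<le> D * ln (real N)"
    using F_part_phase[OF l_mono l_1 a_2 l_growth summ, of "\<delta> / 2"] by blast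
  \<comment> \<open>The first summand pays for the linear loss in the growth of \<theta>, the second
    for at most \<open>2 * max 1 U\<close> unit steps.\<close>
  define C where "C = B / pi / ln 2 + 2 * (D / pi + 1 / ln 2)"
  have "A / pi * ((T + U) * ln (T + U) - T * ln T) - C * (max 1 U * ln (real N))
      \<le> real_of_int (zeros_on_line (zeta_part a l k \<alpha> \<beta> lam \<delta> N) (\<delta> / 2) T U)"
    if N: "N \<ge> 2" and U: "U > 0" and T: "T \<ge> T\<^sub>0"
      and nz: "zeta_part a l k \<alpha> \<beta> lam \<delta> N (Complex (\<delta> / 2) T) \<noteq> 0" for N U T
  proof -
    define f where "f = zeta_part a l k \<alpha> \<beta> lam \<delta> N"
    define Z where "Z = {t. f (Complex (\<delta> / 2) t) = 0}"
    have H: "open {s. Im s > 0}" "connected {s. Im s > 0}"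
      by (auto intro: open_halfspace_Im_gt convex_connected convex_halfspace_Im_gt)
    have hol: "f holomorphic_on {s. Im s > 0}"
      unfolding f_def by (rule zeta_part_holomorphic[OF l_pos \<alpha> lam])
    have ZTU: "{t\<in>Z. T < t \<and> t < T + U} = {t. T < t \<and> t < T + U \<and> f (Complex (\<delta> / 2) t) = 0}"
      by (auto simp: Z_def)
    have fin: "finite {t\<in>Z. T < t \<and> t < T + U}"
      and card: "int (card {t\<in>Z. T < t \<and> t < T + U}) \<le> zeros_on_line f (\<delta> / 2) T U"
      unfolding ZTU using card_zeros_le_zeros_on_line[OF H hol, of T U "\<delta> / 2"] T T0 U nz
      by (simp_all add: f_def)
    \<comment> \<open>The loss per step: the variation of the phase of F_N divided by pi, plus the 1
      lost in \<open>card_cos_zeros_ge\<close>.\<close>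
    define D' where "D' = D * ln (real N) / pi + 1"
    have lnN: "ln (real N) \<ge> ln 2" "ln (real N) > 0"
      using N by auto
    have D'0: "D' \<ge> 0"
      unfolding D'_def using D lnN by simp
    have step: "\<theta> v / pi - \<theta> u / pi - D' \<le> card {t\<in>Z. u < t \<and> t < v}"
      if uv: "T\<^sub>0 \<le> u" "u \<le> v" "v \<le> u + 1" and fin: "finite {t\<in>Z. u < t \<and> t < v}" for u v
    proof -
      obtain q \<phi> :: "real \<Rightarrow> real" where \<phi>: "continuous_on {u..v} \<phi>"
        "\<And>t. t \<in> {u..v} \<Longrightarrow> F_part a l N (Complex (\<delta> / 2) t) = of_real (q t) * cis (\<phi> t)"
        "\<bar>\<phi> v - \<phi> u\<bar> \<le> D * ln (real N)"
        using D(2)[OF N uv(2,3)] by blast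
      have "((\<theta> v + \<phi> v) - (\<theta> u + \<phi> u)) / pi - 1 \<le> card {t\<in>Z. u < t \<and> t < v}"
      proof (rule card_cos_zeros_ge[OF uv(2) _ fin])
        show "continuous_on {u..v} (\<lambda>t. \<theta> t + \<phi> t)"
          unfolding \<theta>_def using uv T0
          by (intro continuous_intros continuous_on_gamma_phase[OF \<alpha>] \<phi>(1)) auto
        fix t assume t: "u < t" "t < v" "cos (\<theta> t + \<phi> t) = 0"
        have "zeta_part a l k \<alpha> \<beta> lam \<delta> N (Complex (\<delta> / 2) t) = 0"
          using t uv T0 \<phi>(2)[of t] unfolding \<theta>_def
          by (intro zeta_part_eq_zero_if_cos_zero[OF l_pos \<alpha> lam a_real]) auto
        then show "t \<in> {t\<in>Z. u < t \<and> t < v}"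
          using t by (simp add: Z_def f_def)
      qed
      moreover have "((\<theta> v + \<phi> v) - (\<theta> u + \<phi> u)) / pi = \<theta> v / pi - \<theta> u / pi + (\<phi> v - \<phi> u) / pi"
        by (simp add: field_simps)
      moreover have "- (D * ln (real N) / pi) \<le> (\<phi> v - \<phi> u) / pi"
        using \<phi>(3) by (simp add: field_simps)
      ultimately show ?thesis
        unfolding D'_def by linarith
    qed
    \<comment> \<open>The number of steps is at most U + 1, which \<open>max 1 U\<close> bounds up
      to a factor 2.\<close>
    define n where "n = nat \<lceil>U\<rceil>"
    have n: "U \<le> n" "n \<le> 2 * max 1 U"
      using U unfolding n_def by linarith+
    have "\<theta> (T + U) / pi - \<theta> T / pi - n * D' \<le> card {t\<in>Z. T < t \<and> t < T + U}"
      by (rule card_ge_sum_over_unit_steps[where T = T\<^sub>0 and \<theta> = "\<lambda>t. \<theta> t / pi"])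
         (use step D'0 T U n fin in auto)
    also have "\<dots> \<le> real_of_int (zeros_on_line f (\<delta> / 2) T U)"
      using card by (metis of_int_le_iff of_int_of_nat_eq)
    finally have 1: "\<theta> (T + U) / pi - \<theta> T / pi - n * D' \<le> real_of_int (zeros_on_line f (\<delta> / 2) T U)" .
    have "(A * ((T + U) * ln (T + U) - T * ln T) - B * U) / pi \<le> (\<theta> (T + U) - \<theta> T) / pi"
      using B(2)[of T "T + U"] T U by (intro divide_right_mono) auto
    then have 2: "A / pi * ((T + U) * ln (T + U) - T * ln T) - B / pi * U \<le> \<theta> (T + U) / pi - \<theta> T / pi"
      by (simp add: diff_divide_distrib)
    have "1 \<le> ln (real N) / ln 2"
      using lnN by simp
    have "n * D' \<le> 2 * max 1 U * D'"
      using n D'0 by (intro mult_right_mono)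
    also have "D' \<le> (D / pi + 1 / ln 2) * ln (real N)"
      using lnN by (simp add: D'_def algebra_simps)
    then have "2 * max 1 U * D' \<le> 2 * max 1 U * ((D / pi + 1 / ln 2) * ln (real N))"
      by (intro mult_left_mono) auto
    finally have 3: "n * D' \<le> 2 * (D / pi + 1 / ln 2) * (max 1 U * ln (real N))"
      by (simp only: mult_ac)
    have "B / pi * U \<le> B / pi * (max 1 U * (ln (real N) / ln 2))"
      using B(1) mult_mono[of U "max 1 U" 1 "ln (real N) / ln 2"] \<open>1 \<le> ln (real N) / ln 2\<close> U
      by (intro mult_left_mono) auto
    then have 4: "B / pi * U \<le> B / pi / ln 2 * (max 1 U * ln (real N))"
      by (simp add: mult_ac)
    have "C * (max 1 U * ln (real N)) = B / pi / ln 2 * (max 1 U * ln (real N)) +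
        2 * (D / pi + 1 / ln 2) * (max 1 U * ln (real N))"
      unfolding C_def by (rule distrib_right)
    then show ?thesis
      using 1 2 3 4 unfolding f_def by linarith
  qed
  then show ?thesis
    using T0 unfolding A_def by blast
qed

end
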